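(* Fix a finite nonempty action set $A$. (i) For every finite nonempty $\Omega$, every prior $\mu_0$ on $\Omega$ with $\mu_0(\omega)>0$ for all $\omega$, and every finite $M$ with $|M|>\max\{|\Omega|,|A|\}$, the Lebesgue measure of the set of environments in $[0,1]^{2|A||\Omega|}$ for which commitment has no value is at least $\frac{1}{|A|^{|A|}}$. (ii) For any sequence $(\Omega_n,\mu_0^n,M_n)$ of finite state spaces with $|\Omega_n|\to\infty$, priors $\mu_0^n$ on $\Omega_n$ with full support, and finite message sets with $|M_n|>\max\{|\Omega_n|,|A|\}$, the Lebesgue measure of the set of environments in $[0,1]^{2|A||\Omega_n|}$ for which commitment has no value converges to $\frac{1}{|A|^{|A|}}$.
   Context: Given $A,\Omega,\mu_0,M$: an environment is a pair $(u_S,u_R)$ of functions $A\times\Omega\to[0,1]$, identified with a point of $[0,1]^{2|A||\Omega|}$. A messaging strategy is $\sigma:\Omega\to\Delta M$ and an action strategy is $\rho:M\to\Delta A$. For $i\in\{S,R\}$, $U_i(\sigma,\rho)=\sum_{\omega,m,a}\mu_0(\omega)\sigma(m|\omega)\rho(a|m)u_i(a,\omega)$. A profile $(\sigma,\rho)$ is S-BR if $\sigma\in\arg\max_{\sigma'}U_S(\sigma',\rho)$, and R-BR if $\rho\in\arg\max_{\rho'}U_R(\sigma,\rho')$. The persuasion payoff is the maximum of $U_S$ over R-BR profiles; the cheap-talk payoff is the maximum of $U_S$ over profiles that are both S-BR and R-BR (cheap-talk equilibria). Commitment has no value if the persuasion payoff equals the cheap-talk payoff. *)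

theory Defs
  imports "HOL-Analysis.Analysis"
begin

definition is_dist :: "'b set \<Rightarrow> ('b \<Rightarrow> real) \<Rightarrow> bool" where
  "is_dist X p \<longleftrightarrow> (\<forall>x\<in>X. 0 \<le> p x) \<and> sum p X = 1"

definition msg_strat :: "'w set \<Rightarrow> 'm set \<Rightarrow> ('w \<Rightarrow> 'm \<Rightarrow> real) \<Rightarrow> bool" where
  "msg_strat \<Omega> M \<sigma> \<longleftrightarrow> (\<forall>w\<in>\<Omega>. is_dist M (\<sigma> w))"

definition act_strat :: "'m set \<Rightarrow> 'a set \<Rightarrow> ('m \<Rightarrow> 'a \<Rightarrow> real) \<Rightarrow> bool" where
  "act_strat M A \<rho> \<longleftrightarrow> (\<forall>m\<in>M. is_dist A (\<rho> m))"

definition payoff ::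
  "'a set \<Rightarrow> 'w set \<Rightarrow> 'm set \<Rightarrow> ('w \<Rightarrow> real) \<Rightarrow> ('a \<Rightarrow> 'w \<Rightarrow> real)
   \<Rightarrow> ('w \<Rightarrow> 'm \<Rightarrow> real) \<Rightarrow> ('m \<Rightarrow> 'a \<Rightarrow> real) \<Rightarrow> real" where
  "payoff A \<Omega> M \<mu>0 u \<sigma> \<rho> =
     (\<Sum>w\<in>\<Omega>. \<Sum>m\<in>M. \<Sum>a\<in>A. \<mu>0 w * \<sigma> w m * \<rho> m a * u a w)"

definition S_BR ::
  "'a set \<Rightarrow> 'w set \<Rightarrow> 'm set \<Rightarrow> ('w \<Rightarrow> real) \<Rightarrow> ('a \<Rightarrow> 'w \<Rightarrow> real)
   \<Rightarrow> ('w \<Rightarrow> 'm \<Rightarrow> real) \<Rightarrow> ('m \<Rightarrow> 'a \<Rightarrow> real) \<Rightarrow> bool" where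
  "S_BR A \<Omega> M \<mu>0 uS \<sigma> \<rho> \<longleftrightarrow>
     msg_strat \<Omega> M \<sigma> \<and> act_strat M A \<rho> \<and>
     (\<forall>\<sigma>'. msg_strat \<Omega> M \<sigma>' \<longrightarrow> payoff A \<Omega> M \<mu>0 uS \<sigma>' \<rho> \<le> payoff A \<Omega> M \<mu>0 uS \<sigma> \<rho>)"

definition R_BR ::
  "'a set \<Rightarrow> 'w set \<Rightarrow> 'm set \<Rightarrow> ('w \<Rightarrow> real) \<Rightarrow> ('a \<Rightarrow> 'w \<Rightarrow> real)
   \<Rightarrow> ('w \<Rightarrow> 'm \<Rightarrow> real) \<Rightarrow> ('m \<Rightarrow> 'a \<Rightarrow> real) \<Rightarrow> bool" where
  "R_BR A \<Omega> M \<mu>0 uR \<sigma> \<rho> \<longleftrightarrow>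
     msg_strat \<Omega> M \<sigma> \<and> act_strat M A \<rho> \<and>
     (\<forall>\<rho>'. act_strat M A \<rho>' \<longrightarrow> payoff A \<Omega> M \<mu>0 uR \<sigma> \<rho>' \<le> payoff A \<Omega> M \<mu>0 uR \<sigma> \<rho>)"

text \<open>Persuasion payoff: maximum (= supremum, attained) of U_S over R-BR profiles.\<close>
definition persuasion_payoff ::
  "'a set \<Rightarrow> 'w set \<Rightarrow> 'm set \<Rightarrow> ('w \<Rightarrow> real) \<Rightarrow> ('a \<Rightarrow> 'w \<Rightarrow> real) \<Rightarrow> ('a \<Rightarrow> 'w \<Rightarrow> real) \<Rightarrow> real" where
  "persuasion_payoff A \<Omega> M \<mu>0 uS uR =
     Sup {payoff A \<Omega> M \<mu>0 uS \<sigma> \<rho> | \<sigma> \<rho>. R_BR A \<Omega> M \<mu>0 uR \<sigma> \<rho>}"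

definition cheap_talk_payoff ::
  "'a set \<Rightarrow> 'w set \<Rightarrow> 'm set \<Rightarrow> ('w \<Rightarrow> real) \<Rightarrow> ('a \<Rightarrow> 'w \<Rightarrow> real) \<Rightarrow> ('a \<Rightarrow> 'w \<Rightarrow> real) \<Rightarrow> real" where
  "cheap_talk_payoff A \<Omega> M \<mu>0 uS uR =
     Sup {payoff A \<Omega> M \<mu>0 uS \<sigma> \<rho> | \<sigma> \<rho>.
            S_BR A \<Omega> M \<mu>0 uS \<sigma> \<rho> \<and> R_BR A \<Omega> M \<mu>0 uR \<sigma> \<rho>}"

definition no_value_commitment ::
  "'a set \<Rightarrow> 'w set \<Rightarrow> 'm set \<Rightarrow> ('w \<Rightarrow> real) \<Rightarrow> ('a \<Rightarrow> 'w \<Rightarrow> real) \<Rightarrow> ('a \<Rightarrow> 'w \<Rightarrow> real) \<Rightarrow> bool" where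
  "no_value_commitment A \<Omega> M \<mu>0 uS uR \<longleftrightarrow>
     persuasion_payoff A \<Omega> M \<mu>0 uS uR = cheap_talk_payoff A \<Omega> M \<mu>0 uS uR"

text \<open>Environments are points e of [0,1]^(2|A||Omega|), indexed by bool x A x Omega:
  u_S a w = e (True, a, w), u_R a w = e (False, a, w).\<close>
definition env_index :: "'a set \<Rightarrow> 'w set \<Rightarrow> (bool \<times> 'a \<times> 'w) set" where
  "env_index A \<Omega> = UNIV \<times> A \<times> \<Omega>"

definition no_value_set :: "'a set \<Rightarrow> 'w set \<Rightarrow> 'm set \<Rightarrow> ('w \<Rightarrow> real) \<Rightarrow> (bool \<times> 'a \<times> 'w \<Rightarrow> real) set" where
  "no_value_set A \<Omega> M \<mu>0 =
     {e \<in> env_index A \<Omega> \<rightarrow>\<^sub>E {0..1}.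
        no_value_commitment A \<Omega> M \<mu>0 (\<lambda>a w. e (True, a, w)) (\<lambda>a w. e (False, a, w))}"

definition env_lebesgue :: "'a set \<Rightarrow> 'w set \<Rightarrow> (bool \<times> 'a \<times> 'w \<Rightarrow> real) measure" where
  "env_lebesgue A \<Omega> = PiM (env_index A \<Omega>) (\<lambda>_. lborel)"

definition is_prior :: "'w set \<Rightarrow> ('w \<Rightarrow> real) \<Rightarrow> bool" where
  "is_prior \<Omega> \<mu>0 \<longleftrightarrow> is_dist \<Omega> \<mu>0"

end

theory Submission
  imports Defs
begin

text \<open>
  Suppose Sender announces his favourite action in every state. If Receiver finds it optimal to follow
  each of these announcements, Sender attains his first best in an equilibrium, so commitment has no
  value. Exchanging Receiver's utilities between actions, separately on each set of states sharing a
  favourite action, preserves Lebesgue measure; hence each of the \<open>|A|^|A|\<close> maps from announcements to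
  optimal replies is equally likely. These maps exhaust almost all environments, which gives the lower
  bound, and they exclude each other when every action is Sender's favourite in some state, which
  gives the matching upper bound for this event.

  Conversely, let commitment have no value. The persuasion payoff is convex in each coordinate of
  \<open>u_S\<close>, so almost surely it has no kink there and the optimal outcome is unique. Were Receiver to
  mix after some message, each action in the support would give an optimal profile with a different
  outcome; so an equilibrium attaining the persuasion payoff is pure and partitions the states. If some
  action \<open>b\<close> were not induced, then in a state where both players strictly prefer \<open>b\<close> a committed Sender
  would reveal that state with small probability; Receiver's other replies are strict almost surely and
  survive, a contradiction. Such aligned states exist for every \<open>b\<close> with probability tending to 1.
\<close>

subsection \<open>Products of Lebesgue measure\<close>

text \<open>Two things decide the form of the argument. The exponent counts maps from
  \<open>A\<close> to \<open>A\<close>. To an announcement that is made in no state every action is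
  an optimal reply, so the events belonging to different maps cover the cube but may overlap.
  Covering yields the lower bound by subadditivity. Disjointness, and with it the upper bound, is
  available only where every announcement occurs. Aligned states guarantee this, besides feeding the
  deviation argument. Uniqueness of the optimal outcome is not obtained by counting the kinks of a
  convex function. For a fixed slope \<open>q\<close>, a line parallel to a coordinate axis of
  Sender's utilities contains at most one point at which the slopes lie on both sides of
  \<open>q\<close>. Hence each such event is null by Fubini, and rational \<open>q\<close> suffice.
  The error term is explicit: a state fails to be aligned for a given action with probability at
  most 1 - 2^(-2|A|), so alignment fails with probability at most |A| (1 - 2^(-2|A|))^|\<Omega>|.
  This involves neither the prior nor the messages, which may therefore vary freely along the
  sequence.\<close>

interpretation lb: product_sigma_finite "\<lambda>_. lborel :: real measure"
  by standard

text \<open>Fubini in coordinate \<open>i\<close>: by \<open>line\<close>, every parallel to that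
  axis meets \<open>S\<close> in at most one point, and a point has length 0. Sender ties, Receiver
  ties and kinks are all shown to be null in this way.\<close>

lemma null_sets_PiM_lborel_line:
  fixes S :: "('i \<Rightarrow> real) set"
  assumes I: "finite I" "i \<in> I" and S: "S \<in> sets (PiM I (\<lambda>_. lborel))"
    and line: "\<And>e y. e \<in> S \<Longrightarrow> e(i := y) \<in> S \<Longrightarrow> y = e i"
  shows "S \<in> null_sets (PiM I (\<lambda>_. lborel))"
proof -
  let ?I = "I - {i}"
  have ins: "insert i ?I = I" using I by auto
  have S': "S \<in> sets (PiM (insert i ?I) (\<lambda>_. lborel))" using S ins by simp
  have inner: "(\<integral>\<^sup>+ y. indicator S (x(i := y)) \<partial>lborel) = (0::ennreal)" for x :: "'i \<Rightarrow> real"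
  proof (cases "\<exists>y. x(i := y) \<in> S")
    case True
    then obtain y0 where y0: "x(i := y0) \<in> S" by auto
    have "y = y0" if "x(i := y) \<in> S" for y
      using line[OF y0, of y] that by simp
    then have "(\<integral>\<^sup>+ y. indicator S (x(i := y)) \<partial>lborel) \<le> (\<integral>\<^sup>+ y. indicator {y0} y \<partial>(lborel::real measure))"
      by (intro nn_integral_mono) (auto simp: indicator_def)
    also have "\<dots> = 0" by simp
    finally show ?thesis by simp
  next
    case False
    then show ?thesis by (simp add: indicator_def)
  qed
  have "emeasure (PiM I (\<lambda>_. lborel)) S = (\<integral>\<^sup>+ e. indicator S e \<partial>PiM (insert i ?I) (\<lambda>_. lborel))"
    using S' ins by simp
  also have "\<dots> = (\<integral>\<^sup>+ x. (\<integral>\<^sup>+ y. indicator S (x(i := y)) \<partial>lborel) \<partial>PiM ?I (\<lambda>_. lborel))"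
    by (rule lb.product_nn_integral_insert) (use I S' in auto)
  also have "\<dots> = 0" by (simp add: inner)
  finally show ?thesis using S by auto
qed

text \<open>Boxes determine the measure, and the preimage of a box is the box with its sides
  permuted, which has the same product of side lengths.\<close>

lemma distr_PiM_lborel_permute:
  assumes I: "finite I" and f: "bij_betw f I I"
  shows "distr (PiM I (\<lambda>_. lborel)) (PiM I (\<lambda>_. lborel)) (\<lambda>e. \<lambda>i\<in>I. e (f i))
       = PiM I (\<lambda>_. lborel :: real measure)"
proof (rule lb.PiM_eqI[OF I])
  fix B :: "'a \<Rightarrow> real set" assume B: "\<And>i. i \<in> I \<Longrightarrow> B i \<in> sets lborel"
  have fI: "f i \<in> I" if "i \<in> I" for i using f that by (auto simp: bij_betw_def)
  have gI: "the_inv_into I f i \<in> I" if "i \<in> I" for i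
    using f that by (metis bij_betw_def order_refl the_inv_into_into)
  have fg: "f (the_inv_into I f i) = i" if "i \<in> I" for i
    using f that by (simp add: bij_betw_def f_the_inv_into_f)
  have gf: "the_inv_into I f (f i) = i" if "i \<in> I" for i
    using f that by (simp add: bij_betw_def the_inv_into_f_f)
  have m: "(\<lambda>e. \<lambda>i\<in>I. e (f i)) \<in> measurable (PiM I (\<lambda>_. lborel)) (PiM I (\<lambda>_. lborel :: real measure))"
    by (intro measurable_restrict measurable_component_singleton fI)
  have pre: "(\<lambda>e. \<lambda>i\<in>I. e (f i)) -` PiE I B \<inter> space (PiM I (\<lambda>_. lborel :: real measure))
       = PiE I (\<lambda>i. B (the_inv_into I f i))" (is "?L = ?R")
  proof (rule set_eqI)
    fix e
    show "e \<in> ?L \<longleftrightarrow> e \<in> ?R"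
      by (simp add: space_PiM PiE_iff) (metis fI gI fg gf)
  qed
  have "emeasure (distr (PiM I (\<lambda>_. lborel)) (PiM I (\<lambda>_. lborel)) (\<lambda>e. \<lambda>i\<in>I. e (f i))) (PiE I B)
      = emeasure (PiM I (\<lambda>_. lborel)) (PiE I (\<lambda>i. B (the_inv_into I f i)))"
    by (subst emeasure_distr[OF m]) (use B I pre in \<open>auto intro!: sets_PiM_I_finite\<close>)
  also have "\<dots> = (\<Prod>i\<in>I. emeasure lborel (B (the_inv_into I f i)))"
    by (rule lb.emeasure_PiM) (use I B gI in auto)
  also have "\<dots> = (\<Prod>i\<in>I. emeasure lborel (B i))"
    by (rule prod.reindex_bij_betw[OF bij_betw_the_inv_into[OF f]])
  finally show "emeasure (distr (PiM I (\<lambda>_. lborel)) (PiM I (\<lambda>_. lborel)) (\<lambda>e. \<lambda>i\<in>I. e (f i))) (PiE I B)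
     = (\<Prod>i\<in>I. emeasure lborel (B i))" .
qed simp

section \<open>Compactness of the unit box and measurable projections along it\<close>

text \<open>Tychonoff. The box runs over the whole type of indices, so that the topology of the
  function type applies directly.\<close>

lemma compact_unit_box: "compact {x :: 'j \<Rightarrow> real. \<forall>j. 0 \<le> x j \<and> x j \<le> 1}"
proof -
  have "{x :: 'j \<Rightarrow> real. \<forall>j. 0 \<le> x j \<and> x j \<le> 1} = PiE UNIV (\<lambda>_. {0..1})"
    by (auto simp: PiE_iff)
  moreover have "compactin (product_topology (\<lambda>_::'j. euclidean) UNIV) (PiE UNIV (\<lambda>_. {0..1::real}))"
    by (simp add: compactin_PiE)
  ultimately show ?thesis
    by (simp add: euclidean_product_topology)
qed

lemma compact_unit_box_sublevels:
  fixes K :: "(('j \<Rightarrow> real) \<Rightarrow> real) set"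
  assumes "\<And>k. k \<in> K \<Longrightarrow> continuous_on UNIV k"
  shows "compact {x. (\<forall>j. 0 \<le> x j \<and> x j \<le> 1) \<and> (\<forall>k\<in>K. k x \<le> 0)}"
proof -
  have "closed (\<Inter>k\<in>K. {x. k x \<le> 0})"
    by (intro closed_INT ballI closed_Collect_le assms continuous_on_const)
  then have "compact ({x. \<forall>j. 0 \<le> x j \<and> x j \<le> 1} \<inter> (\<Inter>k\<in>K. {x. k x \<le> 0}))"
    by (rule compact_Int_closed[OF compact_unit_box])
  moreover have "{x. \<forall>j. 0 \<le> x j \<and> x j \<le> 1} \<inter> (\<Inter>k\<in>K. {x. k x \<le> 0})
     = {x. (\<forall>j. 0 \<le> x j \<and> x j \<le> 1) \<and> (\<forall>k\<in>K. k x \<le> 0)}" by auto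
  ultimately show ?thesis by simp
qed

text \<open>In general a projection of a measurable set need not be measurable. Here compactness
  helps: a continuous function on the box is somewhere at most 0 iff it takes values below every
  1/(n+1), and by continuity these can be looked for on the countable dense set \<open>D\<close>.
  Since \<open>F\<close> depends only on the finitely many coordinates in \<open>J\<close>, those
  outside may be set to 0.\<close>

lemma measurable_ex_unit_box:
  fixes F :: "('j \<Rightarrow> real) \<Rightarrow> 'e \<Rightarrow> real"
  assumes J: "finite J"
    and cont: "\<And>e. e \<in> space N \<Longrightarrow> continuous_on UNIV (\<lambda>x. F x e)"
    and meas: "\<And>x. F x \<in> borel_measurable N"
    and dep: "\<And>x y e. (\<And>j. j \<in> J \<Longrightarrow> x j = y j) \<Longrightarrow> F x e = F y e"
  shows "{e \<in> space N. \<exists>x. (\<forall>j. 0 \<le> x j \<and> x j \<le> 1) \<and> F x e \<le> 0} \<in> sets N"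
proof -
  define D where "D = (\<lambda>f j. if j \<in> J then f j else 0) ` PiE J (\<lambda>_. \<rat> \<inter> {0..1::real})"
  have cD: "countable D"
    unfolding D_def by (intro countable_image countable_PiE J) (auto intro: countable_rat)
  have Dbox: "0 \<le> x j \<and> x j \<le> 1" if "x \<in> D" for x j
    using that by (auto simp: D_def PiE_iff)
  have eq: "{e \<in> space N. \<exists>x. (\<forall>j. 0 \<le> x j \<and> x j \<le> 1) \<and> F x e \<le> 0}
     = (\<Inter>n::nat. \<Union>x\<in>D. {e \<in> space N. F x e < 1 / real (Suc n)})" (is "?L = ?R")
  proof (intro equalityI subsetI)
    fix e assume "e \<in> ?L"
    then obtain x where e: "e \<in> space N" and x: "\<And>j. 0 \<le> x j \<and> x j \<le> 1" "F x e \<le> 0" by auto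
    \<comment> \<open>Rounding down to multiples of 1/(k+1) gives rational points that do not leave
      the unit interval.\<close>
    define y where "y k j = (if j \<in> J then of_int \<lfloor>real (Suc k) * x j\<rfloor> / real (Suc k) else 0)" for k j
    define y' where "y' j = (if j \<in> J then x j else 0)" for j
    have yD: "y k \<in> D" for k
    proof -
      have *: "of_int \<lfloor>real (Suc k) * x j\<rfloor> / real (Suc k) \<in> \<rat> \<inter> {0..1}" for j
      proof -
        have "real_of_int \<lfloor>real (Suc k) * x j\<rfloor> \<le> real (Suc k) * x j" by linarith
        also have "\<dots> \<le> real (Suc k) * 1" using x(1)[of j] by (intro mult_left_mono) auto
        finally have "real_of_int \<lfloor>real (Suc k) * x j\<rfloor> \<le> real (Suc k)" by simp
        moreover have "0 \<le> \<lfloor>real (Suc k) * x j\<rfloor>" using x(1)[of j] by simp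
        ultimately show ?thesis by (auto simp: divide_le_eq intro!: Rats_divide)
      qed
      show ?thesis unfolding D_def
        by (rule image_eqI[where x = "\<lambda>j\<in>J. of_int \<lfloor>real (Suc k) * x j\<rfloor> / real (Suc k)"])
          (use * in \<open>auto simp: y_def fun_eq_iff\<close>)
    qed
    have lim: "(\<lambda>k. y k j) \<longlonglongrightarrow> y' j" for j
    proof (cases "j \<in> J")
      case True
      have "\<bar>y k j - x j\<bar> \<le> 1 / real (Suc k)" for k
      proof -
        have "\<bar>of_int \<lfloor>real (Suc k) * x j\<rfloor> - real (Suc k) * x j\<bar> \<le> 1" by linarith
        then have "\<bar>(of_int \<lfloor>real (Suc k) * x j\<rfloor> - real (Suc k) * x j) / real (Suc k)\<bar> \<le> 1 / real (Suc k)"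
          by (simp add: divide_right_mono)
        then show ?thesis using True by (simp add: y_def diff_divide_distrib del: of_nat_Suc)
      qed
      then have "(\<lambda>k. y k j) \<longlonglongrightarrow> x j"
        by (intro LIMSEQ_norm_0[of "\<lambda>k. y k j - x j", unfolded LIM_zero_iff] LIM_zero_cancel[of _ "x j"])
           (auto intro!: Lim_null_comparison[OF _ LIMSEQ_inverse_real_of_nat] simp: divide_inverse)
      then show ?thesis using True by (simp add: y'_def)
    next
      case False then show ?thesis by (simp add: y_def y'_def)
    qed
    have "limitin (product_topology (\<lambda>_. euclidean) UNIV) y y' sequentially"
      using lim by (simp add: limitin_componentwise)
    then have "y \<longlonglongrightarrow> y'" by (simp add: euclidean_product_topology)
    then have "(\<lambda>k. F (y k) e) \<longlonglongrightarrow> F y' e"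
      using continuous_on_tendsto_compose[OF cont[OF e], of y y' sequentially] by simp
    moreover have "F y' e \<le> 0" using x(2) dep[of y' x e] by (simp add: y'_def)
    ultimately have "\<exists>k. F (y k) e < 1 / real (Suc n)" for n
      by (smt (verit) eventually_sequentially order_tendstoD(2) divide_pos_pos of_nat_0_less_iff zero_less_Suc order_refl)
    then show "e \<in> ?R" using yD e by blast
  next
    fix e assume R: "e \<in> ?R"
    then have e: "e \<in> space N" by auto
    \<comment> \<open>The minimum is attained, so a single point serves for all
      \<open>n\<close>.\<close>
    obtain x0 where x0: "\<And>j. 0 \<le> x0 j \<and> x0 j \<le> 1"
        and min: "\<And>y. (\<And>j. 0 \<le> y j \<and> y j \<le> 1) \<Longrightarrow> F x0 e \<le> F y e"
    proof -
      have "(\<lambda>_. 0) \<in> {x :: 'j \<Rightarrow> real. \<forall>j. 0 \<le> x j \<and> x j \<le> 1}" by simp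
      then have ne: "{x :: 'j \<Rightarrow> real. \<forall>j. 0 \<le> x j \<and> x j \<le> 1} \<noteq> {}" by (metis empty_iff)
      from continuous_attains_inf[OF compact_unit_box ne continuous_on_subset[OF cont[OF e]]]
      show ?thesis using that by auto
    qed
    have "F x0 e \<le> 1 / real (Suc n)" for n
    proof -
      obtain x where "x \<in> D" "F x e < 1 / real (Suc n)" using R by auto
      then show ?thesis using min[of x] Dbox by fastforce
    qed
    then have "F x0 e \<le> 0"
      using LIMSEQ_le_const[OF LIMSEQ_inverse_real_of_nat, of "F x0 e"] by (auto simp: divide_inverse)
    then show "e \<in> ?L" using e x0 by auto
  qed
  have m: "{e \<in> space N. F x e < 1 / real (Suc n)} \<in> sets N" for x n
    using meas by measurable
  show ?thesis unfolding eq
    using m by (intro sets.countable_INT') (auto intro!: sets.countable_UN'' cD simp del: of_nat_Suc)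
qed

text \<open>Finitely many inequalities hold together iff the sum of their positive parts is at most
  0, which reduces them to one continuous inequality.\<close>

lemma measurable_ex_unit_box_constraints:
  fixes K :: "(('j \<Rightarrow> real) \<Rightarrow> 'e \<Rightarrow> real) set"
  assumes J: "finite J" and K: "finite K"
    and cont: "\<And>k e. k \<in> K \<Longrightarrow> e \<in> space N \<Longrightarrow> continuous_on UNIV (\<lambda>x. k x e)"
    and meas: "\<And>k x. k \<in> K \<Longrightarrow> k x \<in> borel_measurable N"
    and dep: "\<And>k x y e. k \<in> K \<Longrightarrow> (\<And>j. j \<in> J \<Longrightarrow> x j = y j) \<Longrightarrow> k x e = k y e"
  shows "{e \<in> space N. \<exists>x. (\<forall>j. 0 \<le> x j \<and> x j \<le> 1) \<and> (\<forall>k\<in>K. k x e \<le> 0)} \<in> sets N"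
proof -
  define F where "F x e = (\<Sum>k\<in>K. max 0 (k x e))" for x e
  have F: "F x e \<le> 0 \<longleftrightarrow> (\<forall>k\<in>K. k x e \<le> 0)" for x e
  proof -
    have "F x e \<ge> 0" by (auto simp: F_def intro!: sum_nonneg)
    moreover have "F x e = 0 \<longleftrightarrow> (\<forall>k\<in>K. max 0 (k x e) = 0)"
      unfolding F_def using K by (intro sum_nonneg_eq_0_iff) auto
    ultimately show ?thesis by (auto simp: max_def split: if_splits)
  qed
  have "{e \<in> space N. \<exists>x. (\<forall>j. 0 \<le> x j \<and> x j \<le> 1) \<and> F x e \<le> 0} \<in> sets N"
  proof (rule measurable_ex_unit_box[OF J])
    show "continuous_on UNIV (\<lambda>x. F x e)" if "e \<in> space N" for e
      unfolding F_def by (intro continuous_intros cont that)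
    show "F x \<in> borel_measurable N" for x
      unfolding F_def[abs_def] by (intro borel_measurable_sum borel_measurable_max borel_measurable_const meas)
    show "F x e = F y e" if "\<And>j. j \<in> J \<Longrightarrow> x j = y j" for x y e
      unfolding F_def
    proof (rule sum.cong[OF refl])
      fix k assume "k \<in> K"
      from dep[OF this that] show "max 0 (k x e) = max 0 (k y e)" by (rule arg_cong)
    qed
  qed
  then show ?thesis by (simp add: F)
qed

section \<open>Convex functions have one kink per slope\<close>

text \<open>\<open>slope\<close> is convexity in terms of supporting lines. At \<open>t\<close> and
  at \<open>t'\<close> the function minus its linear part of slope \<open>q\<close> is strictly
  smaller than at all rational translates. As \<open>t' - t\<close> may be irrational, the two
  points cannot be compared directly. A rational step inside the gap helps: the supporting line at
  its end has slope above \<open>q\<close> coming from \<open>t\<close> and below \<open>q\<close>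
  coming from \<open>t'\<close>, so each of the two values would exceed the other.\<close>

lemma no_two_strict_rational_minima:
  fixes h :: "real \<Rightarrow> real"
  assumes slope: "\<And>s\<^sub>0. \<exists>p. \<forall>s. h s\<^sub>0 + p * (s - s\<^sub>0) \<le> h s"
    and t: "\<And>\<delta>. \<delta> \<in> \<rat> - {0} \<Longrightarrow> h t + q * \<delta> < h (t + \<delta>)"
    and t': "\<And>\<delta>. \<delta> \<in> \<rat> - {0} \<Longrightarrow> h t' + q * \<delta> < h (t' + \<delta>)"
    and "t < t'"
  shows False
proof -
  obtain \<delta> where \<delta>: "\<delta> \<in> \<rat>" "0 < \<delta>" "\<delta> < t' - t" using Rats_dense_in_real[of 0 "t' - t"] \<open>t < t'\<close> by auto
  obtain p where p: "\<And>s. h (t + \<delta>) + p * (s - (t + \<delta>)) \<le> h s" using slope by blast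
  obtain p' where p': "\<And>s. h (t' - \<delta>) + p' * (s - (t' - \<delta>)) \<le> h s" using slope by blast
  have 1: "h t + q * \<delta> < h (t + \<delta>)" using t[of \<delta>] \<delta> by simp
  have 2: "h t' - q * \<delta> < h (t' - \<delta>)" using t'[of "- \<delta>"] \<delta> by simp
  have "p > q"
  proof (rule ccontr)
    assume "\<not> p > q"
    then have "p * \<delta> \<le> q * \<delta>" using \<delta> by (intro mult_right_mono) auto
    then show False using p[of t] 1 by (simp add: algebra_simps)
  qed
  then have "p * (t' - (t + \<delta>)) \<ge> q * (t' - (t + \<delta>))" using \<delta> by (intro mult_right_mono) auto
  then have 3: "h t' > h t + q * (t' - t)" using p[of t'] 1 by (simp add: algebra_simps)
  have "p' < q"
  proof (rule ccontr)
    assume "\<not> p' < q"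
    then have "q * \<delta> \<le> p' * \<delta>" using \<delta> by (intro mult_right_mono) auto
    then show False using p'[of t'] 2 by (simp add: algebra_simps)
  qed
  then have "p' * (t' - \<delta> - t) \<le> q * (t' - \<delta> - t)" using \<delta> by (intro mult_right_mono) auto
  then have "h t > h t' - q * (t' - t)" using p'[of t] 2 by (simp add: algebra_simps)
  then show False using 3 by simp
qed

subsection \<open>Best responses\<close>

definition point_mass :: "'b \<Rightarrow> 'b \<Rightarrow> real" where
  "point_mass a b = (if b = a then 1 else 0)"

lemma is_dist_point_mass: "finite X \<Longrightarrow> a \<in> X \<Longrightarrow> is_dist X (point_mass a)"
  by (simp add: is_dist_def point_mass_def)

lemma sum_point_mass: "finite X \<Longrightarrow> a \<in> X \<Longrightarrow> (\<Sum>b\<in>X. point_mass a b * f b) = f a"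
  by (simp add: point_mass_def if_distrib[of "\<lambda>x. x * _"] cong: if_cong)

lemma is_dist_le:
  assumes "is_dist X p" "\<And>a. a \<in> X \<Longrightarrow> f a \<le> V"
  shows "(\<Sum>a\<in>X. p a * f a) \<le> V"
proof -
  have "(\<Sum>a\<in>X. p a * f a) \<le> (\<Sum>a\<in>X. p a * V)"
    using assms by (intro sum_mono mult_left_mono) (auto simp: is_dist_def)
  also have "\<dots> = V" using assms by (simp add: is_dist_def flip: sum_distrib_right)
  finally show ?thesis .
qed

text \<open>An average can reach an upper bound only if every point of the support does. The bound
  is demanded on the support alone, since actions outside it need not yield admissible
  profiles.\<close>

lemma is_dist_eq_max:
  assumes "finite X" "is_dist X p" "\<And>a. a \<in> X \<Longrightarrow> p a > 0 \<Longrightarrow> f a \<le> V"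
    and "V \<le> (\<Sum>a\<in>X. p a * f a)" and "a \<in> X" "p a > 0"
  shows "f a = V"
proof (rule ccontr)
  assume "f a \<noteq> V"
  then have "f a < V" using assms by force
  have "(\<Sum>a\<in>X. p a * f a) < (\<Sum>a\<in>X. p a * V)"
  proof (rule sum_strict_mono_ex1)
    show "\<forall>x\<in>X. p x * f x \<le> p x * V"
    proof
      fix x assume "x \<in> X"
      then have "p x = 0 \<or> p x > 0" using assms(2) by (auto simp: is_dist_def less_le)
      then show "p x * f x \<le> p x * V" using assms(3) \<open>x \<in> X\<close> by auto
    qed
    show "\<exists>a\<in>X. p a * f a < p a * V" using \<open>f a < V\<close> assms(5,6) by (intro bexI[of _ a] mult_strict_left_mono)
  qed (use assms in auto)
  also have "\<dots> = V" using assms by (simp add: is_dist_def flip: sum_distrib_right)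
  finally show False using assms by simp
qed

lemma is_dist_le_1:
  assumes "finite X" "is_dist X p" "a \<in> X" shows "p a \<le> 1"
  using assms member_le_sum[of a X p] by (auto simp: is_dist_def)

lemma is_dist_ex_pos:
  assumes "is_dist X p" shows "\<exists>a\<in>X. p a > 0"
proof (rule ccontr)
  assume "\<not> ?thesis"
  then have "sum p X \<le> 0" by (intro sum_nonpos) force
  then show False using assms by (simp add: is_dist_def)
qed

locale persuasion =
  fixes A :: "'a set" and \<Omega> :: "'w set" and M :: "'m set" and \<mu>0 :: "'w \<Rightarrow> real"
  assumes finA: "finite A" and neA: "A \<noteq> {}" and fin\<Omega>: "finite \<Omega>" and ne\<Omega>: "\<Omega> \<noteq> {}"
    and prior: "is_dist \<Omega> \<mu>0" and pos: "\<And>w. w \<in> \<Omega> \<Longrightarrow> \<mu>0 w > 0"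
    and finM: "finite M" and cardM: "card A < card M"
begin

abbreviation "index \<equiv> env_index A \<Omega>"
abbreviation "leb \<equiv> env_lebesgue A \<Omega>"
abbreviation uS :: "(bool \<times> 'a \<times> 'w \<Rightarrow> real) \<Rightarrow> 'a \<Rightarrow> 'w \<Rightarrow> real" where "uS e \<equiv> \<lambda>a w. e (True, a, w)"
abbreviation uR :: "(bool \<times> 'a \<times> 'w \<Rightarrow> real) \<Rightarrow> 'a \<Rightarrow> 'w \<Rightarrow> real" where "uR e \<equiv> \<lambda>a w. e (False, a, w)"
abbreviation "pay \<equiv> payoff A \<Omega> M \<mu>0"
abbreviation "SBR \<equiv> S_BR A \<Omega> M \<mu>0"
abbreviation "RBR \<equiv> R_BR A \<Omega> M \<mu>0"
abbreviation "P e \<equiv> persuasion_payoff A \<Omega> M \<mu>0 (uS e) (uR e)"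

text \<open>Expected utility on the event that \<open>m\<close> is sent, not divided by the
  probability of that event. A message that is never sent has value 0 for all actions and thus
  imposes no condition.\<close>

definition action_value :: "('a \<Rightarrow> 'w \<Rightarrow> real) \<Rightarrow> ('w \<Rightarrow> 'm \<Rightarrow> real) \<Rightarrow> 'm \<Rightarrow> 'a \<Rightarrow> real" where
  "action_value u \<sigma> m a = (\<Sum>w\<in>\<Omega>. \<mu>0 w * \<sigma> w m * u a w)"

definition message_value :: "('a \<Rightarrow> 'w \<Rightarrow> real) \<Rightarrow> ('m \<Rightarrow> 'a \<Rightarrow> real) \<Rightarrow> 'w \<Rightarrow> 'm \<Rightarrow> real" where
  "message_value u \<rho> w m = (\<Sum>a\<in>A. \<rho> m a * u a w)"

text \<open>The joint probability of action and state. These numbers are the coefficients of the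
  utilities in the payoff, hence the slopes of the payoff in each utility coordinate.\<close>

definition outcome :: "('w \<Rightarrow> 'm \<Rightarrow> real) \<Rightarrow> ('m \<Rightarrow> 'a \<Rightarrow> real) \<Rightarrow> 'a \<Rightarrow> 'w \<Rightarrow> real" where
  "outcome \<sigma> \<rho> a w = (\<Sum>m\<in>M. \<mu>0 w * \<sigma> w m * \<rho> m a)"

lemma neM: "M \<noteq> {}" using cardM by auto

text \<open>The same triple sum is grouped in three ways: by message for Receiver's problem, by
  state for Sender's, and by action and state for the dependence on utilities.\<close>

lemma pay_action_value: "pay u \<sigma> \<rho> = (\<Sum>m\<in>M. \<Sum>a\<in>A. \<rho> m a * action_value u \<sigma> m a)"
proof -
  have "pay u \<sigma> \<rho> = (\<Sum>m\<in>M. \<Sum>w\<in>\<Omega>. \<Sum>a\<in>A. \<mu>0 w * \<sigma> w m * \<rho> m a * u a w)"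
    unfolding payoff_def by (rule sum.swap)
  also have "\<dots> = (\<Sum>m\<in>M. \<Sum>a\<in>A. \<Sum>w\<in>\<Omega>. \<mu>0 w * \<sigma> w m * \<rho> m a * u a w)"
    by (intro sum.cong refl sum.swap)
  finally show ?thesis by (simp add: action_value_def sum_distrib_left algebra_simps)
qed

lemma pay_message_value: "pay u \<sigma> \<rho> = (\<Sum>w\<in>\<Omega>. \<mu>0 w * (\<Sum>m\<in>M. \<sigma> w m * message_value u \<rho> w m))"
  unfolding payoff_def message_value_def by (simp add: sum_distrib_left algebra_simps)

lemma pay_outcome: "pay u \<sigma> \<rho> = (\<Sum>w\<in>\<Omega>. \<Sum>a\<in>A. outcome \<sigma> \<rho> a w * u a w)"
  unfolding payoff_def outcome_def sum_distrib_right
  by (intro sum.cong refl sum.swap)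

lemma pay_cong:
  assumes "\<And>w m. w \<in> \<Omega> \<Longrightarrow> m \<in> M \<Longrightarrow> \<sigma> w m = \<sigma>' w m"
    and "\<And>m a. m \<in> M \<Longrightarrow> a \<in> A \<Longrightarrow> \<rho> m a = \<rho>' m a"
    and "\<And>w a. w \<in> \<Omega> \<Longrightarrow> a \<in> A \<Longrightarrow> u a w = u' a w"
  shows "pay u \<sigma> \<rho> = pay u' \<sigma>' \<rho>'"
  unfolding payoff_def using assms by (intro sum.cong refl) auto

text \<open>The payoff separates over messages, so deviations to one pure action after one message
  suffice. The comparison is with the average under \<rho> rather than with the support of \<rho>,
  because a weak inequality between polynomials defines a closed set.\<close>

lemma RBR_iff: "RBR u \<sigma> \<rho> \<longleftrightarrow> msg_strat \<Omega> M \<sigma> \<and> act_strat M A \<rho> \<and>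
   (\<forall>m\<in>M. \<forall>a\<in>A. action_value u \<sigma> m a \<le> (\<Sum>b\<in>A. \<rho> m b * action_value u \<sigma> m b))"
proof safe
  assume R: "RBR u \<sigma> \<rho>"
  then show "msg_strat \<Omega> M \<sigma>" and \<rho>: "act_strat M A \<rho>" by (auto simp: R_BR_def)
  fix m a assume m: "m \<in> M" and a: "a \<in> A"
  let ?\<rho> = "\<rho>(m := point_mass a)"
  have "act_strat M A ?\<rho>"
    using \<rho> is_dist_point_mass[OF finA a] by (auto simp: act_strat_def)
  then have "pay u \<sigma> ?\<rho> \<le> pay u \<sigma> \<rho>" using R by (auto simp: R_BR_def)
  moreover have "(\<Sum>n\<in>M - {m}. \<Sum>a\<in>A. ?\<rho> n a * action_value u \<sigma> n a)
      = (\<Sum>n\<in>M - {m}. \<Sum>a\<in>A. \<rho> n a * action_value u \<sigma> n a)"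
    by (intro sum.cong) auto
  ultimately show "action_value u \<sigma> m a \<le> (\<Sum>b\<in>A. \<rho> m b * action_value u \<sigma> m b)"
    using m a by (simp add: pay_action_value sum.remove[OF finM m] sum_point_mass[OF finA a])
next
  assume *: "msg_strat \<Omega> M \<sigma>" "act_strat M A \<rho>"
   "\<forall>m\<in>M. \<forall>a\<in>A. action_value u \<sigma> m a \<le> (\<Sum>b\<in>A. \<rho> m b * action_value u \<sigma> m b)"
  show "RBR u \<sigma> \<rho>" unfolding R_BR_def
  proof (intro conjI allI impI)
    fix \<rho>' assume "act_strat M A \<rho>'"
    then show "pay u \<sigma> \<rho>' \<le> pay u \<sigma> \<rho>"
      unfolding pay_action_value using * by (intro sum_mono is_dist_le) (auto simp: act_strat_def)
  qed (use * in auto)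
qed

text \<open>The payoff separates over states; the positive factor \<mu>0 w can be cancelled.\<close>

lemma SBR_iff: "SBR u \<sigma> \<rho> \<longleftrightarrow> msg_strat \<Omega> M \<sigma> \<and> act_strat M A \<rho> \<and>
   (\<forall>w\<in>\<Omega>. \<forall>m\<in>M. message_value u \<rho> w m \<le> (\<Sum>n\<in>M. \<sigma> w n * message_value u \<rho> w n))"
proof safe
  assume R: "SBR u \<sigma> \<rho>"
  then show "act_strat M A \<rho>" and \<sigma>: "msg_strat \<Omega> M \<sigma>" by (auto simp: S_BR_def)
  fix w m assume w: "w \<in> \<Omega>" and m: "m \<in> M"
  let ?\<sigma> = "\<sigma>(w := point_mass m)"
  have "msg_strat \<Omega> M ?\<sigma>"
    using \<sigma> is_dist_point_mass[OF finM m] by (auto simp: msg_strat_def)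
  then have "pay u ?\<sigma> \<rho> \<le> pay u \<sigma> \<rho>" using R by (auto simp: S_BR_def)
  moreover have "(\<Sum>v\<in>\<Omega> - {w}. \<mu>0 v * (\<Sum>m\<in>M. ?\<sigma> v m * message_value u \<rho> v m))
      = (\<Sum>v\<in>\<Omega> - {w}. \<mu>0 v * (\<Sum>m\<in>M. \<sigma> v m * message_value u \<rho> v m))"
    by (intro sum.cong) auto
  ultimately show "message_value u \<rho> w m \<le> (\<Sum>n\<in>M. \<sigma> w n * message_value u \<rho> w n)"
    using w m pos[OF w] by (simp add: pay_message_value sum.remove[OF fin\<Omega> w] sum_point_mass[OF finM m])
next
  assume *: "msg_strat \<Omega> M \<sigma>" "act_strat M A \<rho>"
   "\<forall>w\<in>\<Omega>. \<forall>m\<in>M. message_value u \<rho> w m \<le> (\<Sum>n\<in>M. \<sigma> w n * message_value u \<rho> w n)"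
  show "SBR u \<sigma> \<rho>" unfolding S_BR_def
  proof (intro conjI allI impI)
    fix \<sigma>' assume "msg_strat \<Omega> M \<sigma>'"
    then show "pay u \<sigma>' \<rho> \<le> pay u \<sigma> \<rho>"
      unfolding pay_message_value using * pos
      by (intro sum_mono mult_left_mono is_dist_le) (auto simp: msg_strat_def less_imp_le)
  qed (use * in auto)
qed

text \<open>An uninformative message answered in the same way as all others leaves Sender
  indifferent. This provides the nonempty feasible sets over which maxima are taken.\<close>

lemma babbling_equilibrium: "\<exists>\<sigma> \<rho>. SBR u \<sigma> \<rho> \<and> RBR v \<sigma> \<rho>"
proof -
  obtain m0 where m0: "m0 \<in> M" using neM by auto
  define \<sigma> where "\<sigma> = (\<lambda>w::'w. point_mass m0)"
  let ?f = "\<lambda>a. action_value v \<sigma> m0 a"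
  have "Max (?f ` A) \<in> ?f ` A" using finA neA by simp
  then obtain a0 where a0: "a0 \<in> A" "?f a0 = Max (?f ` A)" by auto
  have max: "?f a \<le> ?f a0" if "a \<in> A" for a using a0 that finA by simp
  define \<rho> where "\<rho> = (\<lambda>m::'m. point_mass a0)"
  have s: "msg_strat \<Omega> M \<sigma>" "act_strat M A \<rho>"
    using is_dist_point_mass[OF finM m0] is_dist_point_mass[OF finA a0(1)]
    by (auto simp: msg_strat_def act_strat_def \<sigma>_def \<rho>_def)
  have av: "action_value v \<sigma> m a = 0" if "m \<noteq> m0" for m a
    using that by (simp add: action_value_def \<sigma>_def point_mass_def)
  have "RBR v \<sigma> \<rho>" unfolding RBR_iff
  proof (intro conjI ballI s)
    fix m a assume "m \<in> M" "a \<in> A"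
    then show "action_value v \<sigma> m a \<le> (\<Sum>b\<in>A. \<rho> m b * action_value v \<sigma> m b)"
      using max[of a] av[of m] a0(1) by (cases "m = m0") (auto simp: \<rho>_def sum_point_mass[OF finA])
  qed
  moreover have "SBR u \<sigma> \<rho>" unfolding SBR_iff
    using s m0 by (auto simp: \<sigma>_def sum_point_mass[OF finM] message_value_def \<rho>_def)
  ultimately show ?thesis by blast
qed

subsection \<open>Attainment and measurability\<close>

text \<open>Profiles are encoded as points of a product of unit intervals, a compact space, in which the
  equilibrium conditions are finitely many weak inequalities between continuous functions.\<close>
definition dec_msg :: "('w \<times> 'm + 'm \<times> 'a \<Rightarrow> real) \<Rightarrow> 'w \<Rightarrow> 'm \<Rightarrow> real" where
  "dec_msg x w m = x (Inl (w, m))"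

definition dec_act :: "('w \<times> 'm + 'm \<times> 'a \<Rightarrow> real) \<Rightarrow> 'm \<Rightarrow> 'a \<Rightarrow> real" where
  "dec_act x m a = x (Inr (m, a))"

text \<open>Normalisation is an equation and therefore appears as two opposite inequalities;
  nonnegativity comes from the unit box.\<close>

definition strat_constraints ::
  "(('w \<times> 'm + 'm \<times> 'a \<Rightarrow> real) \<Rightarrow> (bool \<times> 'a \<times> 'w \<Rightarrow> real) \<Rightarrow> real) set" where
  "strat_constraints =
     (\<lambda>w x e. (\<Sum>m\<in>M. dec_msg x w m) - 1) ` \<Omega> \<union> (\<lambda>w x e. 1 - (\<Sum>m\<in>M. dec_msg x w m)) ` \<Omega> \<union>
     (\<lambda>m x e. (\<Sum>a\<in>A. dec_act x m a) - 1) ` M \<union> (\<lambda>m x e. 1 - (\<Sum>a\<in>A. dec_act x m a)) ` M"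

definition receiver_constraints ::
  "(('w \<times> 'm + 'm \<times> 'a \<Rightarrow> real) \<Rightarrow> (bool \<times> 'a \<times> 'w \<Rightarrow> real) \<Rightarrow> real) set" where
  "receiver_constraints =
     (\<lambda>(m, a) x e. action_value (uR e) (dec_msg x) m a
        - (\<Sum>b\<in>A. dec_act x m b * action_value (uR e) (dec_msg x) m b)) ` (M \<times> A)"

definition sender_constraints ::
  "(('w \<times> 'm + 'm \<times> 'a \<Rightarrow> real) \<Rightarrow> (bool \<times> 'a \<times> 'w \<Rightarrow> real) \<Rightarrow> real) set" where
  "sender_constraints =
     (\<lambda>(w, m) x e. message_value (uS e) (dec_act x) w m
        - (\<Sum>n\<in>M. dec_msg x w n * message_value (uS e) (dec_act x) w n)) ` (\<Omega> \<times> M)"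

lemma finite_constraints: "finite strat_constraints" "finite receiver_constraints" "finite sender_constraints"
  using finA fin\<Omega> finM by (auto simp: strat_constraints_def receiver_constraints_def sender_constraints_def)

lemma strat_constraints_iff:
  assumes "\<And>j. 0 \<le> x j \<and> x j \<le> 1"
  shows "(\<forall>k\<in>strat_constraints. k x e \<le> 0) \<longleftrightarrow> msg_strat \<Omega> M (dec_msg x) \<and> act_strat M A (dec_act x)"
proof -
  have "0 \<le> dec_msg x w m" "0 \<le> dec_act x m a" for w m a
    using assms by (auto simp: dec_msg_def dec_act_def)
  then show ?thesis
    by (fastforce simp: strat_constraints_def ball_Un msg_strat_def act_strat_def is_dist_def)
qed

lemma receiver_constraints_iff:
  assumes "\<And>j. 0 \<le> x j \<and> x j \<le> 1"
  shows "(\<forall>k\<in>strat_constraints \<union> receiver_constraints. k x e \<le> 0) \<longleftrightarrow> RBR (uR e) (dec_msg x) (dec_act x)"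
  using strat_constraints_iff[of x e] assms by (auto simp: ball_Un RBR_iff receiver_constraints_def)

lemma sender_constraints_iff:
  assumes "\<And>j. 0 \<le> x j \<and> x j \<le> 1"
  shows "(\<forall>k\<in>strat_constraints \<union> sender_constraints. k x e \<le> 0) \<longleftrightarrow> SBR (uS e) (dec_msg x) (dec_act x)"
  using strat_constraints_iff[of x e] assms by (auto simp: ball_Un SBR_iff sender_constraints_def)

abbreviation "profile_index \<equiv> \<Omega> \<times> M <+> M \<times> A"

lemma component_measurable [measurable]:
  "a \<in> A \<Longrightarrow> w \<in> \<Omega> \<Longrightarrow> (\<lambda>e. e (s, a, w)) \<in> borel_measurable leb"
proof -
  assume "a \<in> A" "w \<in> \<Omega>"
  then have "(\<lambda>e. e (s, a, w)) \<in> measurable (PiM index (\<lambda>_. lborel)) lborel"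
    by (intro measurable_component_singleton) (auto simp: env_index_def)
  then show ?thesis by (simp add: env_lebesgue_def)
qed

text \<open>The constraints are polynomials in the profile and in finitely many utilities; the three
  claims are the hypotheses of the projection lemma.\<close>

lemma constraint_regular:
  assumes "k \<in> strat_constraints \<union> receiver_constraints \<union> sender_constraints"
  shows "continuous_on UNIV (\<lambda>x. k x e)" and "k x \<in> borel_measurable leb"
    and "(\<And>j. j \<in> profile_index \<Longrightarrow> x j = y j) \<Longrightarrow> k x e = k y e"
proof -
  note defs = strat_constraints_def receiver_constraints_def sender_constraints_def
    action_value_def message_value_def dec_msg_def dec_act_def
  show "continuous_on UNIV (\<lambda>x. k x e)"
    using assms by (auto simp: defs intro!: continuous_intros)
  show "k x \<in> borel_measurable leb"
    using assms by (auto simp: defs intro!: borel_measurable_sum borel_measurable_diff borel_measurable_times component_measurable)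
  assume *: "\<And>j. j \<in> profile_index \<Longrightarrow> x j = y j"
  have [simp]: "w \<in> \<Omega> \<Longrightarrow> m \<in> M \<Longrightarrow> x (Inl (w, m)) = y (Inl (w, m))"
     "m \<in> M \<Longrightarrow> a \<in> A \<Longrightarrow> x (Inr (m, a)) = y (Inr (m, a))" for w m a
    using * by auto
  show "k x e = k y e"
    using assms by (auto simp: defs intro!: sum.cong arg_cong2[where f = "(-)"] arg_cong2[where f = "(*)"])
qed

lemma pay_regular:
  shows "continuous_on UNIV (\<lambda>x. pay (uS e) (dec_msg x) (dec_act x))"
    and "(\<lambda>e. pay (uS e) \<sigma> \<rho>) \<in> borel_measurable leb"
    and "(\<And>j. j \<in> profile_index \<Longrightarrow> x j = y j) \<Longrightarrow>
        pay u (dec_msg x) (dec_act x) = pay u (dec_msg y) (dec_act y)"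
proof -
  show "continuous_on UNIV (\<lambda>x. pay (uS e) (dec_msg x) (dec_act x))"
    unfolding payoff_def dec_msg_def dec_act_def by (intro continuous_intros) auto
  show "(\<lambda>e. pay (uS e) \<sigma> \<rho>) \<in> borel_measurable leb"
    unfolding payoff_def by (intro borel_measurable_sum borel_measurable_times component_measurable) auto
  show "pay u (dec_msg x) (dec_act x) = pay u (dec_msg y) (dec_act y)"
    if "\<And>j. j \<in> profile_index \<Longrightarrow> x j = y j"
    by (rule pay_cong) (use that in \<open>auto simp: dec_msg_def dec_act_def\<close>)
qed

text \<open>Strategies are arbitrary functions outside their domains. Setting those coordinates to 0
  moves the code into the box and changes neither payoffs nor best responses.\<close>

lemma encode_profile:
  assumes "msg_strat \<Omega> M \<sigma>" "act_strat M A \<rho>"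
  obtains x where "\<And>j. 0 \<le> x j \<and> x j \<le> 1"
    and "\<And>u. pay u (dec_msg x) (dec_act x) = pay u \<sigma> \<rho>"
    and "\<And>u. SBR u (dec_msg x) (dec_act x) \<longleftrightarrow> SBR u \<sigma> \<rho>"
    and "\<And>u. RBR u (dec_msg x) (dec_act x) \<longleftrightarrow> RBR u \<sigma> \<rho>"
proof
  define x where "x j = (case j of Inl p \<Rightarrow> if p \<in> \<Omega> \<times> M then \<sigma> (fst p) (snd p) else 0
     | Inr p \<Rightarrow> if p \<in> M \<times> A then \<rho> (fst p) (snd p) else 0)" for j
  have \<sigma>: "dec_msg x w m = \<sigma> w m" if "w \<in> \<Omega>" "m \<in> M" for w m using that by (simp add: dec_msg_def x_def)
  have \<rho>: "dec_act x m a = \<rho> m a" if "m \<in> M" "a \<in> A" for m a using that by (simp add: dec_act_def x_def)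
  have d: "w \<in> \<Omega> \<Longrightarrow> is_dist M (\<sigma> w)" "m \<in> M \<Longrightarrow> is_dist A (\<rho> m)" for w m
    using assms by (auto simp: msg_strat_def act_strat_def)
  show "0 \<le> x j \<and> x j \<le> 1" for j
    using d is_dist_le_1[OF finM d(1)] is_dist_le_1[OF finA d(2)]
    by (auto simp: x_def is_dist_def split: sum.split)
  show "pay u (dec_msg x) (dec_act x) = pay u \<sigma> \<rho>" for u
    by (rule pay_cong) (auto simp: \<sigma> \<rho>)
  have s: "msg_strat \<Omega> M (dec_msg x) = msg_strat \<Omega> M \<sigma>" "act_strat M A (dec_act x) = act_strat M A \<rho>"
    by (auto simp: msg_strat_def act_strat_def is_dist_def \<sigma> \<rho>)
  have "pay u \<sigma>' (dec_act x) = pay u \<sigma>' \<rho>" "pay u (dec_msg x) \<rho>' = pay u \<sigma> \<rho>'"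
    "pay u (dec_msg x) (dec_act x) = pay u \<sigma> \<rho>" for u \<sigma>' \<rho>'
    by (auto intro!: pay_cong simp: \<sigma> \<rho>)
  then show "SBR u (dec_msg x) (dec_act x) \<longleftrightarrow> SBR u \<sigma> \<rho>" "RBR u (dec_msg x) (dec_act x) \<longleftrightarrow> RBR u \<sigma> \<rho>" for u
    by (auto simp: S_BR_def R_BR_def s)
qed

text \<open>A continuous payoff on a compact set of codes. With \<open>C\<close> as R-BR, or as S-BR
  and R-BR together, it shows that the \<open>Sup\<close> in either payoff definition is a
  maximum.\<close>

lemma constrained_max_attained:
  assumes K: "K \<subseteq> strat_constraints \<union> receiver_constraints \<union> sender_constraints"
    and iff: "\<And>x. (\<And>j. 0 \<le> x j \<and> x j \<le> 1) \<Longrightarrow> (\<forall>k\<in>K. k x e \<le> 0) \<longleftrightarrow> C (dec_msg x) (dec_act x)"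
    and enc: "\<And>\<sigma> \<rho>. C \<sigma> \<rho> \<Longrightarrow> \<exists>x. (\<forall>j. 0 \<le> x j \<and> x j \<le> 1) \<and> C (dec_msg x) (dec_act x)
       \<and> pay (uS e) (dec_msg x) (dec_act x) = pay (uS e) \<sigma> \<rho>"
    and ne: "\<exists>\<sigma> \<rho>. C \<sigma> \<rho>"
  obtains \<sigma> \<rho> where "C \<sigma> \<rho>" and "Sup {pay (uS e) \<sigma> \<rho> | \<sigma> \<rho>. C \<sigma> \<rho>} = pay (uS e) \<sigma> \<rho>"
    and "\<And>\<sigma>' \<rho>'. C \<sigma>' \<rho>' \<Longrightarrow> pay (uS e) \<sigma>' \<rho>' \<le> pay (uS e) \<sigma> \<rho>"
proof -
  define B where "B = {x. (\<forall>j. 0 \<le> x j \<and> x j \<le> 1) \<and> (\<forall>k\<in>(\<lambda>k x. k x e) ` K. k x \<le> 0)}"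
  have comp: "compact B" unfolding B_def
    by (rule compact_unit_box_sublevels) (use K constraint_regular(1) in auto)
  have B_iff: "x \<in> B \<longleftrightarrow> (\<forall>j. 0 \<le> x j \<and> x j \<le> 1) \<and> C (dec_msg x) (dec_act x)" for x
    using iff[of x] by (auto simp: B_def)
  obtain x0 where "x0 \<in> B" using ne enc unfolding B_iff by blast
  then have neB: "B \<noteq> {}" by auto
  obtain x where x: "x \<in> B" and
     max: "\<And>y. y \<in> B \<Longrightarrow> pay (uS e) (dec_msg y) (dec_act y) \<le> pay (uS e) (dec_msg x) (dec_act x)"
    using continuous_attains_sup[OF comp neB continuous_on_subset[OF pay_regular(1)[of e] subset_UNIV]] by blast
  have Cx: "C (dec_msg x) (dec_act x)" using x B_iff by blast
  have le: "pay (uS e) \<sigma>' \<rho>' \<le> pay (uS e) (dec_msg x) (dec_act x)" if "C \<sigma>' \<rho>'" for \<sigma>' \<rho>'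
    using enc[OF that] max B_iff by metis
  show ?thesis
  proof (rule that[OF Cx _ le])
    show "Sup {pay (uS e) \<sigma> \<rho> | \<sigma> \<rho>. C \<sigma> \<rho>} = pay (uS e) (dec_msg x) (dec_act x)"
      by (rule cSup_eq_maximum) (use Cx le in auto)
  qed
qed

lemma persuasion_attained:
  obtains (maximum) \<sigma> \<rho> where "RBR (uR e) \<sigma> \<rho>" and "P e = pay (uS e) \<sigma> \<rho>"
    and "\<And>\<sigma>' \<rho>'. RBR (uR e) \<sigma>' \<rho>' \<Longrightarrow> pay (uS e) \<sigma>' \<rho>' \<le> pay (uS e) \<sigma> \<rho>"
proof (rule constrained_max_attained[of "strat_constraints \<union> receiver_constraints" e "\<lambda>\<sigma> \<rho>. RBR (uR e) \<sigma> \<rho>"])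
  show "(\<forall>k\<in>strat_constraints \<union> receiver_constraints. k x e \<le> 0) \<longleftrightarrow> RBR (uR e) (dec_msg x) (dec_act x)"
    if "\<And>j. 0 \<le> x j \<and> x j \<le> 1" for x using receiver_constraints_iff[OF that] .
  show "\<exists>x. (\<forall>j. 0 \<le> x j \<and> x j \<le> 1) \<and> RBR (uR e) (dec_msg x) (dec_act x)
       \<and> pay (uS e) (dec_msg x) (dec_act x) = pay (uS e) \<sigma> \<rho>" if R: "RBR (uR e) \<sigma> \<rho>" for \<sigma> \<rho>
    using encode_profile[of \<sigma> \<rho>] R unfolding R_BR_def by metis
  show "\<exists>\<sigma> \<rho>. RBR (uR e) \<sigma> \<rho>" using babbling_equilibrium by blast
  show thesis if "RBR (uR e) \<sigma> \<rho>"
    and "Sup {pay (uS e) \<sigma> \<rho> | \<sigma> \<rho>. RBR (uR e) \<sigma> \<rho>} = pay (uS e) \<sigma> \<rho>"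
    and "\<And>\<sigma>' \<rho>'. RBR (uR e) \<sigma>' \<rho>' \<Longrightarrow> pay (uS e) \<sigma>' \<rho>' \<le> pay (uS e) \<sigma> \<rho>" for \<sigma> \<rho>
    by (rule maximum[OF that(1) _ that(3)]) (use that(2) in \<open>simp add: persuasion_payoff_def\<close>)
qed auto

lemma pay_le_P: "RBR (uR e) \<sigma> \<rho> \<Longrightarrow> pay (uS e) \<sigma> \<rho> \<le> P e"
  by (rule persuasion_attained[of e]) simp

text \<open>Every cheap-talk equilibrium is a feasible persuasion profile, so only one of the two
  inequalities between the payoffs has content. In this form it is one more weak constraint on a
  profile.\<close>

lemma no_value_iff:
  "no_value_commitment A \<Omega> M \<mu>0 (uS e) (uR e) \<longleftrightarrow>
     (\<exists>\<sigma> \<rho>. SBR (uS e) \<sigma> \<rho> \<and> RBR (uR e) \<sigma> \<rho> \<and> P e \<le> pay (uS e) \<sigma> \<rho>)"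
proof -
  obtain \<sigma> \<rho> where *: "SBR (uS e) \<sigma> \<rho> \<and> RBR (uR e) \<sigma> \<rho>"
    "Sup {pay (uS e) \<sigma> \<rho> | \<sigma> \<rho>. SBR (uS e) \<sigma> \<rho> \<and> RBR (uR e) \<sigma> \<rho>} = pay (uS e) \<sigma> \<rho>"
    "\<And>\<sigma>' \<rho>'. SBR (uS e) \<sigma>' \<rho>' \<and> RBR (uR e) \<sigma>' \<rho>' \<Longrightarrow> pay (uS e) \<sigma>' \<rho>' \<le> pay (uS e) \<sigma> \<rho>"
  proof (rule constrained_max_attained[of "(strat_constraints \<union> sender_constraints) \<union> (strat_constraints \<union> receiver_constraints)" e
        "\<lambda>\<sigma> \<rho>. SBR (uS e) \<sigma> \<rho> \<and> RBR (uR e) \<sigma> \<rho>"])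
    show "(\<forall>k\<in>(strat_constraints \<union> sender_constraints) \<union> (strat_constraints \<union> receiver_constraints). k x e \<le> 0)
       \<longleftrightarrow> SBR (uS e) (dec_msg x) (dec_act x) \<and> RBR (uR e) (dec_msg x) (dec_act x)"
      if "\<And>j. 0 \<le> x j \<and> x j \<le> 1" for x
      using receiver_constraints_iff[OF that] sender_constraints_iff[OF that] by (simp add: ball_Un)
    show "\<exists>x. (\<forall>j. 0 \<le> x j \<and> x j \<le> 1)
         \<and> (SBR (uS e) (dec_msg x) (dec_act x) \<and> RBR (uR e) (dec_msg x) (dec_act x))
         \<and> pay (uS e) (dec_msg x) (dec_act x) = pay (uS e) \<sigma> \<rho>"
      if R: "SBR (uS e) \<sigma> \<rho> \<and> RBR (uR e) \<sigma> \<rho>" for \<sigma> \<rho>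
    proof -
      have "msg_strat \<Omega> M \<sigma>" "act_strat M A \<rho>" using R by (auto simp: R_BR_def)
      then show ?thesis using encode_profile[of \<sigma> \<rho>] R by metis
    qed
    show "\<exists>\<sigma> \<rho>. SBR (uS e) \<sigma> \<rho> \<and> RBR (uR e) \<sigma> \<rho>" using babbling_equilibrium by blast
  qed auto
  have le: "pay (uS e) \<sigma> \<rho> \<le> P e" using * pay_le_P by blast
  show ?thesis unfolding no_value_commitment_def cheap_talk_payoff_def *(2)
  proof
    assume "P e = pay (uS e) \<sigma> \<rho>"
    then show "\<exists>\<sigma> \<rho>. SBR (uS e) \<sigma> \<rho> \<and> RBR (uR e) \<sigma> \<rho> \<and> P e \<le> pay (uS e) \<sigma> \<rho>"
      using *(1) by auto
  next
    assume "\<exists>\<sigma> \<rho>. SBR (uS e) \<sigma> \<rho> \<and> RBR (uR e) \<sigma> \<rho> \<and> P e \<le> pay (uS e) \<sigma> \<rho>"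
    then have "P e \<le> pay (uS e) \<sigma> \<rho>" using *(3) by (blast intro: order_trans)
    then show "P e = pay (uS e) \<sigma> \<rho>" using le by simp
  qed
qed

text \<open>Superlevel sets of a maximum are projections of constraint sets. The measurability of
  \<open>P\<close> has to come before that of \<open>no_value_set\<close>, where \<open>P e\<close>
  itself enters a constraint.\<close>

lemma measurable_P [measurable]: "P \<in> borel_measurable leb"
proof (rule borel_measurableI_ge)
  fix c :: real
  let ?K = "insert (\<lambda>x e. c - pay (uS e) (dec_msg x) (dec_act x)) (strat_constraints \<union> receiver_constraints)"
  have "{e \<in> space leb. \<exists>x. (\<forall>j. 0 \<le> x j \<and> x j \<le> 1) \<and> (\<forall>k\<in>?K. k x e \<le> 0)} \<in> sets leb"
  proof (rule measurable_ex_unit_box_constraints)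
    show "finite profile_index" using finA finM fin\<Omega> by simp
    show "finite ?K" using finite_constraints by simp
    show "continuous_on UNIV (\<lambda>x. k x e)" if "k \<in> ?K" for k e
      using that constraint_regular(1) pay_regular(1)[of e] by (auto intro!: continuous_intros)
    show "k x \<in> borel_measurable leb" if "k \<in> ?K" for k x
      using that constraint_regular(2) pay_regular(2) by (auto intro!: borel_measurable_diff)
    show "k x e = k y e" if "k \<in> ?K" "\<And>j. j \<in> profile_index \<Longrightarrow> x j = y j" for k x y e
      using that(1) constraint_regular(3)[of k x y e, OF _ that(2)] pay_regular(3)[OF that(2)] by auto
  qed
  also have "{e \<in> space leb. \<exists>x. (\<forall>j. 0 \<le> x j \<and> x j \<le> 1) \<and> (\<forall>k\<in>?K. k x e \<le> 0)} = {e \<in> space leb. c \<le> P e}"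
  proof (intro Collect_cong conj_cong refl iffI)
    fix e assume "\<exists>x. (\<forall>j. 0 \<le> x j \<and> x j \<le> 1) \<and> (\<forall>k\<in>?K. k x e \<le> 0)"
    then obtain x where "RBR (uR e) (dec_msg x) (dec_act x)" "c \<le> pay (uS e) (dec_msg x) (dec_act x)"
      using receiver_constraints_iff by fastforce
    then show "c \<le> P e" using pay_le_P by fastforce
  next
    fix e assume c: "c \<le> P e"
    obtain \<sigma> \<rho> where R: "RBR (uR e) \<sigma> \<rho>" "P e = pay (uS e) \<sigma> \<rho>" using persuasion_attained by metis
    then have "msg_strat \<Omega> M \<sigma>" "act_strat M A \<rho>" by (auto simp: R_BR_def)
    then obtain x where "\<And>j. 0 \<le> x j \<and> x j \<le> 1" "RBR (uR e) (dec_msg x) (dec_act x)"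
      "pay (uS e) (dec_msg x) (dec_act x) = pay (uS e) \<sigma> \<rho>"
      using R encode_profile[of \<sigma> \<rho>] by metis
    then show "\<exists>x. (\<forall>j. 0 \<le> x j \<and> x j \<le> 1) \<and> (\<forall>k\<in>?K. k x e \<le> 0)"
      using receiver_constraints_iff[of x e] R c by (intro exI[of _ x]) auto
  qed
  finally show "{e \<in> space leb. c \<le> P e} \<in> sets leb" .
qed

lemma cube_measurable: "index \<rightarrow>\<^sub>E {0..1} \<in> sets leb"
  unfolding env_lebesgue_def using finA fin\<Omega> by (intro sets_PiM_I_finite) (auto simp: env_index_def)

text \<open>Indispensable, since \<open>measure\<close> is \<open>0\<close> on non-measurable sets and the product of \<open>lborel\<close>
  is not complete.\<close>
lemma no_value_set_measurable: "no_value_set A \<Omega> M \<mu>0 \<in> sets leb"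
proof -
  let ?K = "insert (\<lambda>x e. P e - pay (uS e) (dec_msg x) (dec_act x))
     (strat_constraints \<union> sender_constraints \<union> (strat_constraints \<union> receiver_constraints))"
  have "{e \<in> space leb. \<exists>x. (\<forall>j. 0 \<le> x j \<and> x j \<le> 1) \<and> (\<forall>k\<in>?K. k x e \<le> 0)} \<in> sets leb"
  proof (rule measurable_ex_unit_box_constraints)
    show "finite profile_index" using finA finM fin\<Omega> by simp
    show "finite ?K" using finite_constraints by simp
    show "continuous_on UNIV (\<lambda>x. k x e)" if "k \<in> ?K" for k e
      using that constraint_regular(1) pay_regular(1)[of e] by (auto intro!: continuous_intros)
    show "k x \<in> borel_measurable leb" if "k \<in> ?K" for k x
      using that constraint_regular(2) pay_regular(2) by (auto intro!: borel_measurable_diff measurable_P)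
    show "k x e = k y e" if "k \<in> ?K" "\<And>j. j \<in> profile_index \<Longrightarrow> x j = y j" for k x y e
      using that(1) constraint_regular(3)[of k x y e, OF _ that(2)] pay_regular(3)[OF that(2)] by auto
  qed
  also have "{e \<in> space leb. \<exists>x. (\<forall>j. 0 \<le> x j \<and> x j \<le> 1) \<and> (\<forall>k\<in>?K. k x e \<le> 0)}
     = {e \<in> space leb. no_value_commitment A \<Omega> M \<mu>0 (uS e) (uR e)}"
    unfolding no_value_iff
  proof (intro Collect_cong conj_cong refl iffI)
    fix e assume "\<exists>x. (\<forall>j. 0 \<le> x j \<and> x j \<le> 1) \<and> (\<forall>k\<in>?K. k x e \<le> 0)"
    then obtain x where x: "\<And>j. 0 \<le> x j \<and> x j \<le> 1" and "\<forall>k\<in>?K. k x e \<le> 0" by auto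
    then have "SBR (uS e) (dec_msg x) (dec_act x)" "RBR (uR e) (dec_msg x) (dec_act x)"
        "P e \<le> pay (uS e) (dec_msg x) (dec_act x)"
      using receiver_constraints_iff[of x e] sender_constraints_iff[of x e] by auto
    then show "\<exists>\<sigma> \<rho>. SBR (uS e) \<sigma> \<rho> \<and> RBR (uR e) \<sigma> \<rho> \<and> P e \<le> pay (uS e) \<sigma> \<rho>" by blast
  next
    fix e assume "\<exists>\<sigma> \<rho>. SBR (uS e) \<sigma> \<rho> \<and> RBR (uR e) \<sigma> \<rho> \<and> P e \<le> pay (uS e) \<sigma> \<rho>"
    then obtain \<sigma> \<rho> where R: "SBR (uS e) \<sigma> \<rho>" "RBR (uR e) \<sigma> \<rho>" "P e \<le> pay (uS e) \<sigma> \<rho>" by blast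
    then have "msg_strat \<Omega> M \<sigma>" "act_strat M A \<rho>" by (auto simp: R_BR_def)
    then obtain x where x: "\<And>j. 0 \<le> x j \<and> x j \<le> 1" and "RBR (uR e) (dec_msg x) (dec_act x)"
      "SBR (uS e) (dec_msg x) (dec_act x)"
      "pay (uS e) (dec_msg x) (dec_act x) = pay (uS e) \<sigma> \<rho>"
      using R encode_profile[of \<sigma> \<rho>] by metis
    then show "\<exists>x. (\<forall>j. 0 \<le> x j \<and> x j \<le> 1) \<and> (\<forall>k\<in>?K. k x e \<le> 0)"
      using receiver_constraints_iff[of x e] sender_constraints_iff[of x e] R
      by (intro exI[of _ x]) (auto simp: ball_Un)
  qed
  finally have "{e \<in> space leb. no_value_commitment A \<Omega> M \<mu>0 (uS e) (uR e)} \<in> sets leb" .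
  then have "(index \<rightarrow>\<^sub>E {0..1}) \<inter> {e \<in> space leb. no_value_commitment A \<Omega> M \<mu>0 (uS e) (uR e)} \<in> sets leb"
    by (intro sets.Int cube_measurable)
  also have "(index \<rightarrow>\<^sub>E {0..1}) \<inter> {e \<in> space leb. no_value_commitment A \<Omega> M \<mu>0 (uS e) (uR e)} = no_value_set A \<Omega> M \<mu>0"
    using sets.sets_into_space[OF cube_measurable] by (auto simp: no_value_set_def)
  finally show ?thesis .
qed

subsection \<open>Uniqueness of the optimal outcome\<close>

lemma finite_index: "finite index"
  using finA fin\<Omega> by (simp add: env_index_def)

lemma space_leb: "space leb = extensional index"
  by (simp add: env_lebesgue_def space_PiM PiE_UNIV_domain extensional_def PiE_def)

lemma pay_sender_upd:
  assumes "a \<in> A" "w \<in> \<Omega>"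
  shows "pay (uS (e((True, a, w) := s))) \<sigma> \<rho> = pay (uS e) \<sigma> \<rho> + outcome \<sigma> \<rho> a w * (s - e (True, a, w))"
proof -
  let ?D = "\<lambda>v b. if v = w then if b = a then outcome \<sigma> \<rho> a w * (s - e (True, a, w)) else 0 else 0"
  have "pay (uS (e((True, a, w) := s))) \<sigma> \<rho>
     = (\<Sum>v\<in>\<Omega>. \<Sum>b\<in>A. outcome \<sigma> \<rho> b v * uS e b v + ?D v b)"
    unfolding pay_outcome by (intro sum.cong refl) (auto simp: algebra_simps)
  also have "\<dots> = pay (uS e) \<sigma> \<rho> + (\<Sum>v\<in>\<Omega>. \<Sum>b\<in>A. ?D v b)"
    by (simp add: pay_outcome sum.distrib)
  also have "(\<Sum>v\<in>\<Omega>. \<Sum>b\<in>A. ?D v b) = (\<Sum>v\<in>\<Omega>. if v = w then outcome \<sigma> \<rho> a w * (s - e (True, a, w)) else 0)"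
    using finA assms by (intro sum.cong refl) auto
  finally show ?thesis using fin\<Omega> assms by simp
qed

text \<open>Which profiles are R-BR does not depend on Sender's utility, so along this coordinate
  \<open>P\<close> is a maximum of affine functions. A profile optimal at \<open>s\<^sub>0\<close>
  supplies the supporting line, with its outcome probability as slope.\<close>

lemma P_supporting_slope:
  assumes "a \<in> A" "w \<in> \<Omega>"
  shows "\<exists>p. \<forall>s. P (e((True, a, w) := s\<^sub>0)) + p * (s - s\<^sub>0) \<le> P (e((True, a, w) := s))"
proof -
  let ?e = "\<lambda>s. e((True, a, w) := s)"
  obtain \<sigma> \<rho> where R: "RBR (uR (?e s\<^sub>0)) \<sigma> \<rho>" "P (?e s\<^sub>0) = pay (uS (?e s\<^sub>0)) \<sigma> \<rho>"
    using persuasion_attained[of "?e s\<^sub>0"] by metis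
  have "P (?e s\<^sub>0) + outcome \<sigma> \<rho> a w * (s - s\<^sub>0) \<le> P (?e s)" for s
  proof -
    have "pay (uS (?e s)) \<sigma> \<rho> = pay (uS (?e s\<^sub>0)) \<sigma> \<rho> + outcome \<sigma> \<rho> a w * (s - s\<^sub>0)"
      unfolding pay_sender_upd[OF assms] by (simp add: algebra_simps)
    moreover have "RBR (uR (?e s)) \<sigma> \<rho>" using R(1) by simp
    ultimately show ?thesis using pay_le_P[of "?e s" \<sigma> \<rho>] R(2) by simp
  qed
  then show ?thesis by blast
qed

text \<open>Contains every environment with two optimal persuasion profiles whose outcome
  probabilities of \<open>(a, w)\<close> lie on different sides of \<open>q\<close>.\<close>
definition kink_set :: "'a \<Rightarrow> 'w \<Rightarrow> real \<Rightarrow> (bool \<times> 'a \<times> 'w \<Rightarrow> real) set" where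
  "kink_set a w q = {e \<in> space leb. \<forall>\<delta>\<in>\<rat> - {0}.
     P e + q * \<delta> < P (e((True, a, w) := e (True, a, w) + \<delta>))}"

text \<open>Rational \<delta> make this a countable intersection, each member of which compares
  \<open>P\<close> at a point and at its translate.\<close>

lemma kink_set_measurable:
  assumes "a \<in> A" "w \<in> \<Omega>"
  shows "kink_set a w q \<in> sets leb"
proof -
  have m[measurable]: "(\<lambda>e. e((True, a, w) := e (True, a, w) + \<delta>)) \<in> measurable leb leb" for \<delta>
    unfolding env_lebesgue_def
  proof (rule measurable_fun_upd[where J = index])
    show "index = index \<union> {(True, a, w)}" using assms by (auto simp: env_index_def)
    show "(\<lambda>e. e (True, a, w) + \<delta>) \<in> measurable (PiM index (\<lambda>_. lborel)) lborel"
      using component_measurable[OF assms, of True] by (auto simp: env_lebesgue_def intro!: borel_measurable_add)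
  qed simp
  have "{e \<in> space leb. P e + q * \<delta> < P (e((True, a, w) := e (True, a, w) + \<delta>))} \<in> sets leb" for \<delta>
    by measurable
  then have "(\<Inter>\<delta>\<in>\<rat> - {0::real}. {e \<in> space leb. P e + q * \<delta> < P (e((True, a, w) := e (True, a, w) + \<delta>))}) \<in> sets leb"
    by (intro sets.countable_INT') (auto intro: countable_rat intro!: exI[of _ "1::real"])
  also have "(\<Inter>\<delta>\<in>\<rat> - {0::real}. {e \<in> space leb. P e + q * \<delta> < P (e((True, a, w) := e (True, a, w) + \<delta>))}) = kink_set a w q"
  proof -
    have "1 \<in> \<rat> - {0::real}" by simp
    then show ?thesis by (auto simp: kink_set_def simp del: Diff_iff)
  qed
  finally show ?thesis .
qed

lemma kink_set_null:
  assumes aw: "a \<in> A" "w \<in> \<Omega>"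
  shows "kink_set a w q \<in> null_sets leb"
  unfolding env_lebesgue_def
proof (rule null_sets_PiM_lborel_line[where i = "(True, a, w)"])
  show "finite index" by (rule finite_index)
  show "(True, a, w) \<in> index" using aw by (simp add: env_index_def)
  show "kink_set a w q \<in> sets (PiM index (\<lambda>_. lborel))"
    using kink_set_measurable[OF aw] by (simp add: env_lebesgue_def)
  fix e y assume e: "e \<in> kink_set a w q" and e': "e((True, a, w) := y) \<in> kink_set a w q"
  define h where "h s = P (e((True, a, w) := s))" for s
  have slope: "\<exists>p. \<forall>s. h s\<^sub>0 + p * (s - s\<^sub>0) \<le> h s" for s\<^sub>0
    unfolding h_def by (rule P_supporting_slope[OF aw])
  have t: "h (e (True, a, w)) + q * \<delta> < h (e (True, a, w) + \<delta>)" if "\<delta> \<in> \<rat> - {0}" for \<delta>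
    using e that by (simp add: kink_set_def h_def)
  have t': "h y + q * \<delta> < h (y + \<delta>)" if "\<delta> \<in> \<rat> - {0}" for \<delta>
    using e' that unfolding kink_set_def h_def mem_Collect_eq fun_upd_upd fun_upd_same by blast
  show "y = e (True, a, w)"
    using no_two_strict_rational_minima[OF slope t t'] no_two_strict_rational_minima[OF slope t' t]
    by (meson linorder_neqE_linordered_idom)
qed

lemma optimal_action_pure:
  assumes e: "e \<in> space leb" and generic: "\<And>a w q. a \<in> A \<Longrightarrow> w \<in> \<Omega> \<Longrightarrow> q \<in> \<rat> \<Longrightarrow> e \<notin> kink_set a w q"
    and R: "RBR (uR e) \<sigma> \<rho>" and opt: "P e \<le> pay (uS e) \<sigma> \<rho>"
    and m: "m \<in> M" and w: "w \<in> \<Omega>" and sent: "\<sigma> w m > 0"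
    and a: "a \<in> A" "\<rho> m a > 0" and b: "b \<in> A" "\<rho> m b > 0"
  shows "a = b"
proof (rule ccontr)
  assume ab: "a \<noteq> b"
  have strat: "msg_strat \<Omega> M \<sigma>" "act_strat M A \<rho>" using R by (auto simp: R_BR_def)
  have d: "is_dist A (\<rho> m)" using strat m by (simp add: act_strat_def)
  define \<rho>' where "\<rho>' c = \<rho>(m := point_mass c)" for c
  have RBR': "RBR (uR e) \<sigma> (\<rho>' c)" if c: "c \<in> A" "\<rho> m c > 0" for c
  proof -
    have eq: "action_value (uR e) \<sigma> m c = (\<Sum>b\<in>A. \<rho> m b * action_value (uR e) \<sigma> m b)"
      by (rule is_dist_eq_max[OF finA d _ order_refl c]) (use R m in \<open>auto simp: RBR_iff\<close>)
    have "act_strat M A (\<rho>' c)"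
      using strat is_dist_point_mass[OF finA c(1)] by (auto simp: act_strat_def \<rho>'_def)
    then show ?thesis
      using R strat c eq by (auto simp: RBR_iff \<rho>'_def sum_point_mass[OF finA])
  qed
  have pay': "pay (uS e) \<sigma> (\<rho>' c)
     = action_value (uS e) \<sigma> m c + (\<Sum>n\<in>M - {m}. \<Sum>a\<in>A. \<rho> n a * action_value (uS e) \<sigma> n a)" if "c \<in> A" for c
  proof -
    have "(\<Sum>n\<in>M - {m}. \<Sum>a\<in>A. \<rho>' c n a * action_value (uS e) \<sigma> n a)
      = (\<Sum>n\<in>M - {m}. \<Sum>a\<in>A. \<rho> n a * action_value (uS e) \<sigma> n a)"
      by (intro sum.cong) (auto simp: \<rho>'_def)
    then show ?thesis
      by (simp add: pay_action_value sum.remove[OF finM m] \<rho>'_def sum_point_mass[OF finA that])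
  qed
  let ?rest = "\<Sum>n\<in>M - {m}. \<Sum>a\<in>A. \<rho> n a * action_value (uS e) \<sigma> n a"
  \<comment> \<open>The payoff of the mixture is the average of the payoffs of its pure
    replacements. Those from the support do not exceed \<open>P e\<close>, so all of them attain
    it.\<close>
  have "(\<Sum>c\<in>A. \<rho> m c * pay (uS e) \<sigma> (\<rho>' c))
      = (\<Sum>c\<in>A. \<rho> m c * action_value (uS e) \<sigma> m c + \<rho> m c * ?rest)"
    by (intro sum.cong refl) (simp add: pay' distrib_left)
  also have "\<dots> = (\<Sum>c\<in>A. \<rho> m c * action_value (uS e) \<sigma> m c) + sum (\<rho> m) A * ?rest"
    by (simp only: sum.distrib sum_distrib_right)
  also have "\<dots> = pay (uS e) \<sigma> \<rho>"
    using d by (simp add: pay_action_value sum.remove[OF finM m] is_dist_def)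
  finally have opt': "P e \<le> (\<Sum>c\<in>A. \<rho> m c * pay (uS e) \<sigma> (\<rho>' c))" using opt by simp
  have eqP: "pay (uS e) \<sigma> (\<rho>' c) = P e" if "c \<in> A" "\<rho> m c > 0" for c
    by (rule is_dist_eq_max[OF finA d _ opt' that]) (use RBR' pay_le_P in auto)
  have out: "outcome \<sigma> (\<rho>' c) a w = \<mu>0 w * \<sigma> w m * point_mass c a + (\<Sum>n\<in>M - {m}. \<mu>0 w * \<sigma> w n * \<rho> n a)" for c
  proof -
    have "(\<Sum>n\<in>M - {m}. \<mu>0 w * \<sigma> w n * \<rho>' c n a) = (\<Sum>n\<in>M - {m}. \<mu>0 w * \<sigma> w n * \<rho> n a)"
      by (intro sum.cong) (auto simp: \<rho>'_def)
    then show ?thesis by (simp add: outcome_def sum.remove[OF finM m] \<rho>'_def)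
  qed
  \<comment> \<open>The replacements differ only after \<open>m\<close>, so these probabilities are
    \<mu>0 w * \<sigma> w m apart. A rational number in between selects one of countably many kink
    sets.\<close>
  have "outcome \<sigma> (\<rho>' b) a w < outcome \<sigma> (\<rho>' a) a w"
    unfolding out using ab sent pos[OF w] by (simp add: point_mass_def)
  then obtain q where q: "q \<in> \<rat>" "outcome \<sigma> (\<rho>' b) a w < q" "q < outcome \<sigma> (\<rho>' a) a w"
    using Rats_dense_in_real by blast
  have "e \<in> kink_set a w q" unfolding kink_set_def mem_Collect_eq
  proof (intro conjI ballI e)
    fix \<delta> :: real assume "\<delta> \<in> \<rat> - {0}"
    then have "\<delta> \<noteq> 0" by simp
    let ?e = "e((True, a, w) := e (True, a, w) + \<delta>)"
    have le: "P e + outcome \<sigma> (\<rho>' c) a w * \<delta> \<le> P ?e" if "c \<in> A" "\<rho> m c > 0" for c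
    proof -
      have "RBR (uR ?e) \<sigma> (\<rho>' c)" using RBR'[OF that] by simp
      then have "pay (uS ?e) \<sigma> (\<rho>' c) \<le> P ?e" by (rule pay_le_P)
      then show ?thesis unfolding pay_sender_upd[OF a(1) w] using eqP[OF that] by simp
    qed
    \<comment> \<open>The profile with the larger slope beats the line of slope \<open>q\<close> to
      the right, the one with the smaller slope beats it to the left.\<close>
    show "P e + q * \<delta> < P ?e"
    proof (cases "\<delta> > 0")
      case True
      then have "q * \<delta> < outcome \<sigma> (\<rho>' a) a w * \<delta>" using q by (intro mult_strict_right_mono)
      then show ?thesis using le[OF a] by simp
    next
      case False
      then have "q * \<delta> < outcome \<sigma> (\<rho>' b) a w * \<delta>"
        using q \<open>\<delta> \<noteq> 0\<close> by (intro mult_strict_right_mono_neg) auto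
      then show ?thesis using le[OF b] by simp
    qed
  qed
  then show False using generic[OF a(1) w q(1)] by simp
qed

subsection \<open>Following Sender's favourites\<close>

text \<open>The profile that announces \<open>c w\<close> in state \<open>w\<close>, modified so that in state \<open>v\<close> the action \<open>b\<close>
  is announced with probability \<open>\<epsilon>\<close>.\<close>
lemma split_profile:
  assumes c: "\<And>w. w \<in> \<Omega> \<Longrightarrow> c w \<in> A" and v: "v \<in> \<Omega>" and b: "b \<in> A" and \<epsilon>: "0 \<le> \<epsilon>" "\<epsilon> \<le> 1"
  obtains \<sigma> \<rho> where "msg_strat \<Omega> M \<sigma>" "act_strat M A \<rho>"
    and "\<And>u. pay u \<sigma> \<rho> = (\<Sum>w\<in>\<Omega>. \<mu>0 w * u (c w) w) + \<epsilon> * \<mu>0 v * (u b v - u (c v) v)"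
    and "\<And>u. (\<forall>x\<in>A. \<forall>d\<in>A.
        (\<Sum>w\<in>{w\<in>\<Omega>. c w = x}. \<mu>0 w * u d w) + \<epsilon> * \<mu>0 v * u d v * (point_mass b x - point_mass (c v) x)
        \<le> (\<Sum>w\<in>{w\<in>\<Omega>. c w = x}. \<mu>0 w * u x w) + \<epsilon> * \<mu>0 v * u x v * (point_mass b x - point_mass (c v) x))
      \<Longrightarrow> RBR u \<sigma> \<rho>"
proof -
  obtain g where g: "inj_on g A" "g ` A \<subseteq> M"
    using card_le_inj[OF finA finM] cardM by auto
  \<comment> \<open>Messages outside the range of \<open>g\<close> are never sent, so any reply to
    them is optimal; \<open>b\<close> is a default.\<close>
  define h where "h m = (if m \<in> g ` A then inv_into A g m else b)" for m
  have hg: "h (g x) = x" if "x \<in> A" for x using that g(1) by (simp add: h_def)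
  have hA: "h m \<in> A" for m using b by (auto simp: h_def inv_into_into)
  \<comment> \<open>Mass \<epsilon> moves from the message for \<open>c v\<close> to the one for
    \<open>b\<close>. If \<open>b = c v\<close> the two terms cancel, so this case needs no separate
    treatment.\<close>
  define \<sigma> where "\<sigma> w m = point_mass (g (c w)) m
      + (if w = v then \<epsilon> * (point_mass (g b) m - point_mass (g (c v)) m) else 0)" for w m
  define \<rho> where "\<rho> m = point_mass (h m)" for m
  have gM: "g x \<in> M" if "x \<in> A" for x using that g(2) by auto
  have pm: "sum (point_mass (g x)) M = 1" if "x \<in> A" for x
    using is_dist_point_mass[OF finM gM[OF that]] unfolding is_dist_def by blast
  have \<rho>: "act_strat M A \<rho>"
    using is_dist_point_mass[OF finA hA] by (simp add: act_strat_def \<rho>_def)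
  have \<sigma>: "msg_strat \<Omega> M \<sigma>" unfolding msg_strat_def is_dist_def
  proof (intro ballI conjI)
    fix w m assume "w \<in> \<Omega>" "m \<in> M"
    have "\<sigma> w m = (if w = v then (1 - \<epsilon>) * point_mass (g (c v)) m + \<epsilon> * point_mass (g b) m
        else point_mass (g (c w)) m)" by (simp add: \<sigma>_def algebra_simps)
    moreover have "0 \<le> point_mass x m" for x :: 'm by (simp add: point_mass_def)
    ultimately show "0 \<le> \<sigma> w m" using \<epsilon> by simp
  next
    fix w assume w: "w \<in> \<Omega>"
    show "sum (\<sigma> w) M = 1"
      unfolding \<sigma>_def using pm[OF c[OF w]] pm[OF c[OF v]] pm[OF b]
      by (cases "w = v") (simp_all add: sum.distrib sum_subtractf flip: sum_distrib_left)
  qed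
  have mv: "message_value u \<rho> w m = u (h m) w" for u w m
    by (simp add: message_value_def \<rho>_def sum_point_mass[OF finA hA])
  have "(\<Sum>m\<in>M. \<sigma> w m * u (h m) w) = u (c w) w + (if w = v then \<epsilon> * (u b v - u (c v) v) else 0)"
    if w: "w \<in> \<Omega>" for u w
  proof -
    have s: "(\<Sum>m\<in>M. point_mass (g x) m * u (h m) w) = u x w" if "x \<in> A" for x
      using sum_point_mass[OF finM gM[OF that], of "\<lambda>m. u (h m) w"] hg[OF that] by simp
    have "(\<Sum>m\<in>M. \<sigma> w m * u (h m) w) = (\<Sum>m\<in>M. point_mass (g (c w)) m * u (h m) w)
       + (if w = v then \<epsilon> * ((\<Sum>m\<in>M. point_mass (g b) m * u (h m) w)
            - (\<Sum>m\<in>M. point_mass (g (c v)) m * u (h m) w)) else 0)"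
      by (auto simp: \<sigma>_def algebra_simps sum.distrib sum_subtractf sum_distrib_left)
    then show ?thesis using s c w v b by auto
  qed
  then have "pay u \<sigma> \<rho> = (\<Sum>w\<in>\<Omega>. \<mu>0 w * u (c w) w + (if w = v then \<mu>0 v * \<epsilon> * (u b v - u (c v) v) else 0))" for u
    unfolding pay_message_value mv by (intro sum.cong refl) (auto simp: algebra_simps)
  then have pay: "pay u \<sigma> \<rho> = (\<Sum>w\<in>\<Omega>. \<mu>0 w * u (c w) w) + \<epsilon> * \<mu>0 v * (u b v - u (c v) v)" for u
    using fin\<Omega> v by (simp add: sum.distrib)
  have av: "action_value u \<sigma> m d = (\<Sum>w\<in>{w\<in>\<Omega>. g (c w) = m}. \<mu>0 w * u d w)
     + \<epsilon> * \<mu>0 v * u d v * (point_mass (g b) m - point_mass (g (c v)) m)" for u m d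
  proof -
    have "action_value u \<sigma> m d = (\<Sum>w\<in>\<Omega>. (if g (c w) = m then \<mu>0 w * u d w else 0)
        + (if w = v then \<epsilon> * \<mu>0 v * u d v * (point_mass (g b) m - point_mass (g (c v)) m) else 0))"
      unfolding action_value_def
      by (intro sum.cong refl) (auto simp: \<sigma>_def point_mass_def algebra_simps)
    then show ?thesis using fin\<Omega> v by (simp add: sum.distrib sum.inter_filter)
  qed
  have R: "RBR u \<sigma> \<rho>" if u: "\<forall>x\<in>A. \<forall>d\<in>A.
        (\<Sum>w\<in>{w\<in>\<Omega>. c w = x}. \<mu>0 w * u d w) + \<epsilon> * \<mu>0 v * u d v * (point_mass b x - point_mass (c v) x)
        \<le> (\<Sum>w\<in>{w\<in>\<Omega>. c w = x}. \<mu>0 w * u x w) + \<epsilon> * \<mu>0 v * u x v * (point_mass b x - point_mass (c v) x)"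
    for u
    unfolding RBR_iff
  proof (intro conjI ballI \<sigma> \<rho>)
    fix m d assume m: "m \<in> M" and d: "d \<in> A"
    have "(\<Sum>b\<in>A. \<rho> m b * action_value u \<sigma> m b) = action_value u \<sigma> m (h m)"
      by (simp add: \<rho>_def sum_point_mass[OF finA hA])
    moreover have "action_value u \<sigma> m d \<le> action_value u \<sigma> m (h m)"
    proof (cases "m \<in> g ` A")
      case True
      then obtain x where x: "x \<in> A" "m = g x" by auto
      have inj: "g y = m \<longleftrightarrow> y = x" if "y \<in> A" for y using x g(1) that by (auto dest: inj_onD)
      have 1: "{w\<in>\<Omega>. g (c w) = m} = {w\<in>\<Omega>. c w = x}" using inj c by auto
      have 2: "point_mass (g y) m = point_mass y x" if "y \<in> A" for y
        using inj[OF that] by (auto simp: point_mass_def)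
      show ?thesis unfolding av 1 2[OF b] 2[OF c[OF v]] using u x d hg by simp
    next
      case False
      then have cell: "{w\<in>\<Omega>. g (c w) = m} = {}" and "m \<noteq> g b" "m \<noteq> g (c v)" using c b v by auto
      then show ?thesis unfolding av cell by (simp add: point_mass_def)
    qed
    ultimately show "action_value u \<sigma> m d \<le> (\<Sum>b\<in>A. \<rho> m b * action_value u \<sigma> m b)" by simp
  qed
  show ?thesis by (rule that[OF \<sigma> \<rho> pay R])
qed

definition strict_sender :: "(bool \<times> 'a \<times> 'w \<Rightarrow> real) \<Rightarrow> bool" where
  "strict_sender e \<longleftrightarrow> (\<forall>w\<in>\<Omega>. \<forall>a\<in>A. \<forall>b\<in>A. a \<noteq> b \<longrightarrow> uS e a w \<noteq> uS e b w)"

text \<open>\<open>W\<close> stands for the cell of states that lead to one action. As the partition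
  is not known beforehand, all nonempty sets are covered; on the empty set all actions tie.\<close>

definition no_receiver_ties :: "(bool \<times> 'a \<times> 'w \<Rightarrow> real) \<Rightarrow> bool" where
  "no_receiver_ties e \<longleftrightarrow> (\<forall>W\<in>Pow \<Omega> - {{}}. \<forall>a\<in>A. \<forall>b\<in>A. a \<noteq> b \<longrightarrow>
     (\<Sum>w\<in>W. \<mu>0 w * uR e a w) \<noteq> (\<Sum>w\<in>W. \<mu>0 w * uR e b w))"

definition aligned_states :: "(bool \<times> 'a \<times> 'w \<Rightarrow> real) \<Rightarrow> bool" where
  "aligned_states e \<longleftrightarrow> (\<forall>b\<in>A. \<exists>w\<in>\<Omega>. \<forall>a\<in>A - {b}. uS e a w < uS e b w \<and> uR e a w < uR e b w)"

definition is_best :: "(bool \<times> 'a \<times> 'w \<Rightarrow> real) \<Rightarrow> 'w \<Rightarrow> 'a \<Rightarrow> bool" where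
  "is_best e w a \<longleftrightarrow> a \<in> A \<and> (\<forall>b\<in>A. uS e b w \<le> uS e a w)"

text \<open>\<open>r a\<close> is an optimal reply to the announcement \<open>a\<close>. If
  \<open>a\<close> is nobody's favourite in any state, both sums are empty and \<open>r a\<close> is
  unconstrained, which is why several \<open>r\<close> may fit one environment.\<close>

definition replies :: "('a \<Rightarrow> 'a) \<Rightarrow> (bool \<times> 'a \<times> 'w \<Rightarrow> real) \<Rightarrow> bool" where
  "replies r e \<longleftrightarrow> (\<forall>a\<in>A. \<forall>b\<in>A. (\<Sum>w\<in>{w\<in>\<Omega>. is_best e w a}. \<mu>0 w * uR e b w)
      \<le> (\<Sum>w\<in>{w\<in>\<Omega>. is_best e w a}. \<mu>0 w * uR e (r a) w))"

lemma ex_is_best: "\<exists>a. is_best e w a"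
proof -
  have "Max ((\<lambda>a. uS e a w) ` A) \<in> (\<lambda>a. uS e a w) ` A" using finA neA by simp
  then obtain a where "a \<in> A" "uS e a w = Max ((\<lambda>a. uS e a w) ` A)" by auto
  then show ?thesis unfolding is_best_def using finA by (intro exI[of _ a]) auto
qed

lemma is_best_unique:
  assumes "strict_sender e" "w \<in> \<Omega>" "is_best e w a" "is_best e w b" shows "a = b"
  using assms unfolding strict_sender_def is_best_def by (meson order_antisym)

lemma favourites_replies_imp_no_value:
  assumes S: "strict_sender e" and r: "replies (\<lambda>a. a) e"
  shows "no_value_commitment A \<Omega> M \<mu>0 (uS e) (uR e)"
proof -
  obtain c where c: "\<And>w. is_best e w (c w)" using ex_is_best by metis
  have cA: "c w \<in> A" for w using c by (simp add: is_best_def)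
  obtain v where v: "v \<in> \<Omega>" using ne\<Omega> by auto
  \<comment> \<open>\<open>b = c v\<close> and \<epsilon> = 0 give the announcement profile without
    perturbation.\<close>
  obtain \<sigma> \<rho> where s: "msg_strat \<Omega> M \<sigma>" "act_strat M A \<rho>"
    and pay: "pay (uS e) \<sigma> \<rho> = (\<Sum>w\<in>\<Omega>. \<mu>0 w * uS e (c w) w)"
    and R: "(\<forall>x\<in>A. \<forall>d\<in>A.
        (\<Sum>w\<in>{w\<in>\<Omega>. c w = x}. \<mu>0 w * uR e d w) \<le> (\<Sum>w\<in>{w\<in>\<Omega>. c w = x}. \<mu>0 w * uR e x w)) \<Longrightarrow> RBR (uR e) \<sigma> \<rho>"
    by (rule split_profile[of c v "c v" 0]) (use cA v in auto)
  have cell: "{w\<in>\<Omega>. c w = x} = {w\<in>\<Omega>. is_best e w x}" for x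
    using c is_best_unique[OF S] by blast
  have RBR: "RBR (uR e) \<sigma> \<rho>" by (rule R) (use r in \<open>simp add: cell replies_def\<close>)
  \<comment> \<open>\<open>c w\<close> is best for Sender state by state, so the bound holds against
    all pairs of strategies. It yields both S-BR and optimality under commitment.\<close>
  have le: "pay (uS e) \<sigma>' \<rho>' \<le> pay (uS e) \<sigma> \<rho>" if "msg_strat \<Omega> M \<sigma>'" "act_strat M A \<rho>'" for \<sigma>' \<rho>'
    unfolding pay unfolding pay_message_value message_value_def
    using that c pos by (intro sum_mono mult_left_mono is_dist_le)
      (auto simp: msg_strat_def act_strat_def is_best_def less_imp_le)
  have "SBR (uS e) \<sigma> \<rho>" using le s by (simp add: S_BR_def)
  moreover have "P e \<le> pay (uS e) \<sigma> \<rho>"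
  proof -
    obtain \<sigma>' \<rho>' where "RBR (uR e) \<sigma>' \<rho>'" "P e = pay (uS e) \<sigma>' \<rho>'" using persuasion_attained[of e] by metis
    then show ?thesis using le by (simp add: R_BR_def)
  qed
  ultimately show ?thesis unfolding no_value_iff using RBR by blast
qed

text \<open>The equilibrium defines a map \<open>c\<close> from states to induced actions. It
  remains to see that \<open>c\<close> picks Sender's favourites and that Receiver's optimality
  passes from single messages to the cells of \<open>c\<close>.\<close>

lemma no_value_imp_favourites_replies:
  assumes e: "e \<in> space leb"
    and kink: "\<And>a w q. a \<in> A \<Longrightarrow> w \<in> \<Omega> \<Longrightarrow> q \<in> \<rat> \<Longrightarrow> e \<notin> kink_set a w q"
    and S: "strict_sender e" and T: "no_receiver_ties e" and al: "aligned_states e"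
    and nv: "no_value_commitment A \<Omega> M \<mu>0 (uS e) (uR e)"
  shows "replies (\<lambda>a. a) e"
proof -
  obtain \<sigma> \<rho> where SBR: "SBR (uS e) \<sigma> \<rho>" and RBR: "RBR (uR e) \<sigma> \<rho>" and opt: "P e \<le> pay (uS e) \<sigma> \<rho>"
    using nv no_value_iff by blast
  have d\<sigma>: "is_dist M (\<sigma> w)" if "w \<in> \<Omega>" for w using SBR that by (auto simp: S_BR_def msg_strat_def)
  have d\<rho>: "is_dist A (\<rho> m)" if "m \<in> M" for m using SBR that by (auto simp: S_BR_def act_strat_def)
  \<comment> \<open>Purity of the reply is available only after messages that are sent.\<close>
  define on where "on = {m\<in>M. \<exists>w\<in>\<Omega>. \<sigma> w m > 0}"
  have "\<exists>a\<in>A. \<forall>b\<in>A. \<rho> m b = point_mass a b" if m: "m \<in> on" for m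
  proof -
    from m obtain w where w: "m \<in> M" "w \<in> \<Omega>" "\<sigma> w m > 0" by (auto simp: on_def)
    obtain a where a: "a \<in> A" "\<rho> m a > 0" using is_dist_ex_pos[OF d\<rho>[OF w(1)]] by auto
    have z: "\<rho> m b = 0" if "b \<in> A" "b \<noteq> a" for b
      using optimal_action_pure[OF e kink RBR opt w a that(1)] d\<rho>[OF w(1)] that
      by (fastforce simp: is_dist_def less_le)
    have "sum (\<rho> m) A = \<rho> m a" using z a finA by (simp add: sum.remove[OF finA a(1)])
    then have "\<rho> m a = 1" using d\<rho>[OF w(1)] by (simp add: is_dist_def)
    then show ?thesis using a z by (intro bexI[of _ a]) (auto simp: point_mass_def)
  qed
  then obtain \<alpha> where \<alpha>: "\<And>m. m \<in> on \<Longrightarrow> \<alpha> m \<in> A" "\<And>m b. m \<in> on \<Longrightarrow> b \<in> A \<Longrightarrow> \<rho> m b = point_mass (\<alpha> m) b"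
    by metis
  have sum_\<rho>: "(\<Sum>b\<in>A. \<rho> m b * f b) = f (\<alpha> m)" if "m \<in> on" for m f
    using \<alpha>[OF that] sum_point_mass[OF finA, of "\<alpha> m" f] by simp
  have mv: "message_value u \<rho> w m = u (\<alpha> m) w" if "m \<in> on" for u w m
    unfolding message_value_def by (rule sum_\<rho>[OF that])
  have sopt: "uS e (\<alpha> n) w \<le> uS e (\<alpha> m) w" if w: "w \<in> \<Omega>" "\<sigma> w m > 0" "m \<in> on" "n \<in> on" for w m n
  proof -
    have "message_value (uS e) \<rho> w m = (\<Sum>n\<in>M. \<sigma> w n * message_value (uS e) \<rho> w n)"
      by (rule is_dist_eq_max[OF finM d\<sigma>[OF w(1)] _ order_refl]) (use SBR w in \<open>auto simp: SBR_iff on_def\<close>)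
    then have "message_value (uS e) \<rho> w n \<le> message_value (uS e) \<rho> w m"
      using SBR w by (simp add: SBR_iff on_def)
    then show ?thesis using w by (simp add: mv)
  qed
  have onI: "m \<in> on" if "w \<in> \<Omega>" "m \<in> M" "\<sigma> w m > 0" for w m using that by (auto simp: on_def)
  \<comment> \<open>Messages used in the same state are equally good for Sender, so in the absence
    of ties they induce the same action.\<close>
  have "\<exists>x\<in>\<alpha> ` on. \<forall>m\<in>M. \<sigma> w m > 0 \<longrightarrow> \<alpha> m = x" if w: "w \<in> \<Omega>" for w
  proof -
    obtain m where m: "m \<in> M" "\<sigma> w m > 0" using is_dist_ex_pos[OF d\<sigma>[OF w]] by auto
    have "\<alpha> n = \<alpha> m" if "n \<in> M" "\<sigma> w n > 0" for n
      using sopt[of w n m] sopt[of w m n] onI m w that S \<alpha>(1) unfolding strict_sender_def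
      by (metis order_antisym)
    then show ?thesis using onI[OF w m] by blast
  qed
  then obtain c where c: "\<And>w. w \<in> \<Omega> \<Longrightarrow> c w \<in> \<alpha> ` on"
    and c\<alpha>: "\<And>w m. w \<in> \<Omega> \<Longrightarrow> m \<in> M \<Longrightarrow> \<sigma> w m > 0 \<Longrightarrow> \<alpha> m = c w" by metis
  have cA: "c w \<in> A" if "w \<in> \<Omega>" for w using c[OF that] \<alpha>(1) by auto
  have cmax: "uS e x w \<le> uS e (c w) w" if w: "w \<in> \<Omega>" and x: "x \<in> \<alpha> ` on" for w x
  proof -
    obtain m where m: "m \<in> M" "\<sigma> w m > 0" using is_dist_ex_pos[OF d\<sigma>[OF w]] by auto
    then show ?thesis using sopt[OF w m(2) onI[OF w m]] x c\<alpha>[OF w m] by auto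
  qed
  have zero: "\<sigma> w m = 0" if "w \<in> \<Omega>" "m \<in> M" "\<not> \<sigma> w m > 0" for w m
    using d\<sigma>[OF that(1)] that by (auto simp: is_dist_def less_le)
  \<comment> \<open>States with \<open>c w = x\<close> put all their mass on messages inducing
    \<open>x\<close>, other states put none. Merging these messages restores the prior weights of
    the cell.\<close>
  have cell_sum: "(\<Sum>m\<in>{m\<in>on. \<alpha> m = x}. action_value u \<sigma> m d) = (\<Sum>w\<in>{w\<in>\<Omega>. c w = x}. \<mu>0 w * u d w)" for u x d
  proof -
    have *: "(\<Sum>m\<in>{m\<in>on. \<alpha> m = x}. \<sigma> w m) = (if c w = x then 1 else 0)" if w: "w \<in> \<Omega>" for w
    proof (cases "c w = x")
      case True
      have "(\<Sum>m\<in>{m\<in>on. \<alpha> m = x}. \<sigma> w m) = (\<Sum>m\<in>M. \<sigma> w m)"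
        by (rule sum.mono_neutral_left[OF finM]) (use zero[OF w] c\<alpha>[OF w] onI[OF w] True in \<open>auto simp: on_def\<close>)
      then show ?thesis using d\<sigma>[OF w] True by (simp add: is_dist_def)
    next
      case False
      then have "\<sigma> w m = 0" if "m \<in> {m\<in>on. \<alpha> m = x}" for m
        using zero[OF w, of m] c\<alpha>[OF w, of m] that by (cases "\<sigma> w m > 0") (auto simp: on_def)
      then show ?thesis using False by (simp add: sum.neutral)
    qed
    have "(\<Sum>m\<in>{m\<in>on. \<alpha> m = x}. action_value u \<sigma> m d) = (\<Sum>w\<in>\<Omega>. \<Sum>m\<in>{m\<in>on. \<alpha> m = x}. \<mu>0 w * \<sigma> w m * u d w)"
      unfolding action_value_def by (rule sum.swap)
    also have "\<dots> = (\<Sum>w\<in>\<Omega>. \<mu>0 w * u d w * (\<Sum>m\<in>{m\<in>on. \<alpha> m = x}. \<sigma> w m))"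
      by (simp add: sum_distrib_left algebra_simps)
    also have "\<dots> = (\<Sum>w\<in>\<Omega>. if c w = x then \<mu>0 w * u d w else 0)"
      by (intro sum.cong refl) (simp add: *)
    also have "\<dots> = (\<Sum>w\<in>{w\<in>\<Omega>. c w = x}. \<mu>0 w * u d w)"
      using fin\<Omega> by (simp add: sum.inter_filter)
    finally show ?thesis .
  qed
  have Rcell: "(\<Sum>w\<in>{w\<in>\<Omega>. c w = x}. \<mu>0 w * uR e d w) \<le> (\<Sum>w\<in>{w\<in>\<Omega>. c w = x}. \<mu>0 w * uR e x w)"
    if "d \<in> A" for x d
  proof -
    have "action_value (uR e) \<sigma> m d \<le> action_value (uR e) \<sigma> m x" if m: "m \<in> {m\<in>on. \<alpha> m = x}" for m
    proof -
      have "action_value (uR e) \<sigma> m d \<le> (\<Sum>b\<in>A. \<rho> m b * action_value (uR e) \<sigma> m b)"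
        using RBR \<open>d \<in> A\<close> m by (auto simp: RBR_iff on_def)
      then show ?thesis using m by (simp add: sum_\<rho>)
    qed
    then have "(\<Sum>m\<in>{m\<in>on. \<alpha> m = x}. action_value (uR e) \<sigma> m d) \<le> (\<Sum>m\<in>{m\<in>on. \<alpha> m = x}. action_value (uR e) \<sigma> m x)"
      by (rule sum_mono)
    then show ?thesis by (simp only: cell_sum)
  qed
  have pay: "pay (uS e) \<sigma> \<rho> = (\<Sum>w\<in>\<Omega>. \<mu>0 w * uS e (c w) w)"
    unfolding pay_message_value
  proof (rule sum.cong[OF refl])
    fix w assume w: "w \<in> \<Omega>"
    have "(\<Sum>m\<in>M. \<sigma> w m * message_value (uS e) \<rho> w m) = (\<Sum>m\<in>M. \<sigma> w m * uS e (c w) w)"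
    proof (rule sum.cong[OF refl])
      fix m assume m: "m \<in> M"
      show "\<sigma> w m * message_value (uS e) \<rho> w m = \<sigma> w m * uS e (c w) w"
        using zero[OF w m] c\<alpha>[OF w m] onI[OF w m] mv by (cases "\<sigma> w m > 0") auto
    qed
    also have "\<dots> = uS e (c w) w" using d\<sigma>[OF w] by (simp add: is_dist_def flip: sum_distrib_right)
    finally show "\<mu>0 w * (\<Sum>m\<in>M. \<sigma> w m * message_value (uS e) \<rho> w m) = \<mu>0 w * uS e (c w) w" by simp
  qed
  have all: "b \<in> \<alpha> ` on" if b: "b \<in> A" for b
  proof (rule ccontr)
    assume nb: "b \<notin> \<alpha> ` on"
    obtain v where v: "v \<in> \<Omega>" and vb: "\<And>a. a \<in> A - {b} \<Longrightarrow> uS e a v < uS e b v \<and> uR e a v < uR e b v"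
      using al b unfolding aligned_states_def by blast
    have cvb: "c v \<noteq> b" using c[OF v] nb by auto
    \<comment> \<open>Receiver's margin for \<open>c v\<close> over \<open>d\<close> in the cell of
      \<open>v\<close>. The cell is nonempty, so the absence of ties makes the margin
      strict.\<close>
    define D where "D d = (\<Sum>w\<in>{w\<in>\<Omega>. c w = c v}. \<mu>0 w * uR e (c v) w) - (\<Sum>w\<in>{w\<in>\<Omega>. c w = c v}. \<mu>0 w * uR e d w)" for d
    have D: "D d > 0" if d: "d \<in> A - {c v}" for d
    proof -
      have "{w\<in>\<Omega>. c w = c v} \<in> Pow \<Omega> - {{}}" using v by auto
      then have "D d \<noteq> 0" unfolding D_def using T d cA[OF v] unfolding no_receiver_ties_def by fastforce
      moreover have "D d \<ge> 0" unfolding D_def using Rcell[of d "c v"] d by simp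
      ultimately show ?thesis by simp
    qed
    \<comment> \<open>Withdrawing a share \<epsilon> of state \<open>v\<close> changes each margin
      by a multiple of \<epsilon>; finitely many positive margins survive when \<epsilon> is
      small.\<close>
    have "\<forall>\<^sub>F \<epsilon> in at_right 0. 0 < D d - \<epsilon> * (\<mu>0 v * (uR e (c v) v - uR e d v))" if "d \<in> A - {c v}" for d
    proof (rule order_tendstoD(1)[OF _ D[OF that]])
      have "((\<lambda>\<epsilon>. D d - \<epsilon> * (\<mu>0 v * (uR e (c v) v - uR e d v))) \<longlongrightarrow>
           D d - 0 * (\<mu>0 v * (uR e (c v) v - uR e d v))) (at_right 0)"
        by (intro tendsto_intros)
      then show "((\<lambda>\<epsilon>. D d - \<epsilon> * (\<mu>0 v * (uR e (c v) v - uR e d v))) \<longlongrightarrow> D d) (at_right 0)" by simp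
    qed
    then have "\<forall>\<^sub>F \<epsilon> in at_right 0. \<forall>d\<in>A - {c v}. 0 < D d - \<epsilon> * (\<mu>0 v * (uR e (c v) v - uR e d v))"
      using finA by (intro eventually_ball_finite) auto
    moreover have "\<forall>\<^sub>F \<epsilon> in at_right (0::real). \<epsilon> < 1"
      by (rule order_tendstoD(2)[of _ 0]) (auto intro: tendsto_intros)
    moreover have "\<forall>\<^sub>F \<epsilon> in at_right (0::real). \<epsilon> > 0" by (simp add: eventually_at_right_less)
    ultimately have "\<forall>\<^sub>F \<epsilon> in at_right 0. (\<forall>d\<in>A - {c v}. 0 < D d - \<epsilon> * (\<mu>0 v * (uR e (c v) v - uR e d v))) \<and> \<epsilon> < 1 \<and> \<epsilon> > 0"
      by eventually_elim auto
    from eventually_happens[OF this] obtain \<epsilon>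
      where \<epsilon>: "\<And>d. d \<in> A - {c v} \<Longrightarrow> 0 < D d - \<epsilon> * (\<mu>0 v * (uR e (c v) v - uR e d v))" "\<epsilon> < 1" "\<epsilon> > 0"
      by (auto simp: trivial_limit_at_right_real)
    obtain \<sigma>' \<rho>' where "msg_strat \<Omega> M \<sigma>'" "act_strat M A \<rho>'"
      and pay': "\<And>u. pay u \<sigma>' \<rho>' = (\<Sum>w\<in>\<Omega>. \<mu>0 w * u (c w) w) + \<epsilon> * \<mu>0 v * (u b v - u (c v) v)"
      and R': "\<And>u. (\<forall>x\<in>A. \<forall>d\<in>A.
        (\<Sum>w\<in>{w\<in>\<Omega>. c w = x}. \<mu>0 w * u d w) + \<epsilon> * \<mu>0 v * u d v * (point_mass b x - point_mass (c v) x)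
        \<le> (\<Sum>w\<in>{w\<in>\<Omega>. c w = x}. \<mu>0 w * u x w) + \<epsilon> * \<mu>0 v * u x v * (point_mass b x - point_mass (c v) x))
        \<Longrightarrow> RBR u \<sigma>' \<rho>'"
      by (rule split_profile[of c v b \<epsilon>, OF cA v b less_imp_le[OF \<epsilon>(3)] less_imp_le[OF \<epsilon>(2)]]) (assumption, rule that)
    have "RBR (uR e) \<sigma>' \<rho>'"
    proof (intro R' ballI)
      fix x d assume x: "x \<in> A" and d: "d \<in> A"
      have \<epsilon>\<mu>: "\<epsilon> * \<mu>0 v > 0" using \<epsilon> pos[OF v] by simp
      consider "x = b" | "x = c v" | "x \<noteq> b" "x \<noteq> c v" by auto
      then show "(\<Sum>w\<in>{w\<in>\<Omega>. c w = x}. \<mu>0 w * uR e d w) + \<epsilon> * \<mu>0 v * uR e d v * (point_mass b x - point_mass (c v) x)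
        \<le> (\<Sum>w\<in>{w\<in>\<Omega>. c w = x}. \<mu>0 w * uR e x w) + \<epsilon> * \<mu>0 v * uR e x v * (point_mass b x - point_mass (c v) x)"
      proof cases
        case 1
        \<comment> \<open>No state was assigned to \<open>b\<close>, so its message now reveals
          \<open>v\<close>, where \<open>b\<close> is Receiver's best action.\<close>
        then have cell: "{w\<in>\<Omega>. c w = x} = {}" using c nb by auto
        have "uR e d v \<le> uR e b v" using vb[of d] d by (cases "d = b") auto
        then show ?thesis unfolding cell using 1 cvb \<epsilon>\<mu> by (auto simp: point_mass_def intro!: mult_left_mono)
      next
        case 2
        have "0 \<le> D d - \<epsilon> * (\<mu>0 v * (uR e (c v) v - uR e d v))"
          using \<epsilon>(1)[of d] d by (cases "d = c v") (auto simp: D_def)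
        then show ?thesis using 2 cvb by (simp add: D_def point_mass_def algebra_simps)
      next
        case 3
        then show ?thesis using Rcell[OF d] by (simp add: point_mass_def)
      qed
    qed
    then have "pay (uS e) \<sigma>' \<rho>' \<le> pay (uS e) \<sigma> \<rho>" using pay_le_P opt by fastforce
    moreover have "\<epsilon> * \<mu>0 v * (uS e b v - uS e (c v) v) > 0"
      using \<epsilon> pos[OF v] vb[of "c v"] cA[OF v] cvb by simp
    ultimately show False unfolding pay pay' by simp
  qed
  \<comment> \<open>Since every action is induced, best among the induced actions means best in
    \<open>A\<close>.\<close>
  have "{w\<in>\<Omega>. c w = x} = {w\<in>\<Omega>. is_best e w x}" for x
  proof -
    have "is_best e w (c w)" if "w \<in> \<Omega>" for w
      unfolding is_best_def using cA[OF that] cmax[OF that] all by blast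
    then show ?thesis using is_best_unique[OF S] by blast
  qed
  then show ?thesis using Rcell by (simp add: replies_def)
qed

subsection \<open>Genericity and symmetry\<close>

definition generic :: "(bool \<times> 'a \<times> 'w \<Rightarrow> real) \<Rightarrow> bool" where
  "generic e \<longleftrightarrow> strict_sender e \<and> no_receiver_ties e \<and> (\<forall>a\<in>A. \<forall>w\<in>\<Omega>. \<forall>q\<in>\<rat>. e \<notin> kink_set a w q)"

lemma index_mem [simp]: "(s, a, w) \<in> index \<longleftrightarrow> a \<in> A \<and> w \<in> \<Omega>"
  by (simp add: env_index_def)

lemma sender_tie_null:
  assumes "w \<in> \<Omega>" "a \<in> A" "b \<in> A" "a \<noteq> b"
  shows "{e \<in> space leb. uS e a w = uS e b w} \<in> null_sets leb"
  unfolding env_lebesgue_def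
proof (rule null_sets_PiM_lborel_line[where i = "(True, a, w)"])
  have "{e \<in> space leb. uS e a w = uS e b w} \<in> sets leb" using assms by measurable
  then show "{e \<in> space (PiM index (\<lambda>_. lborel)). uS e a w = uS e b w} \<in> sets (PiM index (\<lambda>_. lborel))"
    by (simp add: env_lebesgue_def)
qed (use assms finite_index in auto)

text \<open>With the other coordinates fixed, the tie is an affine equation in Receiver's utility of
  \<open>a\<close> at some \<open>v\<close> in \<open>W\<close>. Its coefficient \<mu>0 v is
  positive, so it has one solution.\<close>

lemma receiver_tie_null:
  assumes W: "W \<subseteq> \<Omega>" "W \<noteq> {}" and ab: "a \<in> A" "b \<in> A" "a \<noteq> b"
  shows "{e \<in> space leb. (\<Sum>w\<in>W. \<mu>0 w * uR e a w) = (\<Sum>w\<in>W. \<mu>0 w * uR e b w)} \<in> null_sets leb"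
proof -
  obtain v where v: "v \<in> W" "v \<in> \<Omega>" using W by auto
  have finW: "finite W" using W fin\<Omega> finite_subset by blast
  show ?thesis unfolding env_lebesgue_def
  proof (rule null_sets_PiM_lborel_line[where i = "(False, a, v)"])
    have [measurable]: "(\<lambda>e. \<Sum>w\<in>W. \<mu>0 w * uR e x w) \<in> borel_measurable leb" if "x \<in> A" for x
      using W that by (intro borel_measurable_sum borel_measurable_times component_measurable) auto
    have "{e \<in> space leb. (\<Sum>w\<in>W. \<mu>0 w * uR e a w) = (\<Sum>w\<in>W. \<mu>0 w * uR e b w)} \<in> sets leb"
      using ab by measurable
    then show "{e \<in> space (PiM index (\<lambda>_. lborel)). (\<Sum>w\<in>W. \<mu>0 w * uR e a w) = (\<Sum>w\<in>W. \<mu>0 w * uR e b w)}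
        \<in> sets (PiM index (\<lambda>_. lborel))" by (simp add: env_lebesgue_def)
    fix e :: "bool \<times> 'a \<times> 'w \<Rightarrow> real" and y
    let ?e = "e((False, a, v) := y)"
    assume "e \<in> {e \<in> space (PiM index (\<lambda>_. lborel)). (\<Sum>w\<in>W. \<mu>0 w * uR e a w) = (\<Sum>w\<in>W. \<mu>0 w * uR e b w)}"
      and "?e \<in> {e \<in> space (PiM index (\<lambda>_. lborel)). (\<Sum>w\<in>W. \<mu>0 w * uR e a w) = (\<Sum>w\<in>W. \<mu>0 w * uR e b w)}"
    then have 1: "(\<Sum>w\<in>W. \<mu>0 w * uR e a w) = (\<Sum>w\<in>W. \<mu>0 w * uR e b w)"
      and 2: "(\<Sum>w\<in>W. \<mu>0 w * uR ?e a w) = (\<Sum>w\<in>W. \<mu>0 w * uR ?e b w)" by blast+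
    have 3: "(\<Sum>w\<in>W. \<mu>0 w * uR ?e b w) = (\<Sum>w\<in>W. \<mu>0 w * uR e b w)" using ab by simp
    have "(\<Sum>w\<in>W - {v}. \<mu>0 w * uR ?e a w) = (\<Sum>w\<in>W - {v}. \<mu>0 w * uR e a w)"
      by (intro sum.cong) auto
    moreover have "(\<Sum>w\<in>W. \<mu>0 w * uR ?e a w) = (\<Sum>w\<in>W. \<mu>0 w * uR e a w)" using 1 2 3 by simp
    ultimately have "\<mu>0 v * y = \<mu>0 v * uR e a v" by (simp add: sum.remove[OF finW v(1)])
    then show "y = e (False, a, v)" using pos[OF v(2)] by simp
  qed (use v ab finite_index in auto)
qed

lemma nongeneric_null: "{e \<in> space leb. \<not> generic e} \<in> null_sets leb"
proof -
  let ?S = "\<Union>w\<in>\<Omega>. \<Union>a\<in>A. \<Union>b\<in>{b\<in>A. a \<noteq> b}. {e \<in> space leb. uS e a w = uS e b w}"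
  let ?T = "\<Union>W\<in>Pow \<Omega> - {{}}. \<Union>a\<in>A. \<Union>b\<in>{b\<in>A. a \<noteq> b}.
     {e \<in> space leb. (\<Sum>w\<in>W. \<mu>0 w * uR e a w) = (\<Sum>w\<in>W. \<mu>0 w * uR e b w)}"
  let ?K = "\<Union>a\<in>A. \<Union>w\<in>\<Omega>. \<Union>q\<in>\<rat>. kink_set a w q"
  have "?S \<in> null_sets leb"
    using finA fin\<Omega> by (intro null_sets_UN' countable_finite sender_tie_null) auto
  moreover have "?T \<in> null_sets leb"
    using finA fin\<Omega> by (intro null_sets_UN' countable_finite receiver_tie_null) auto
  moreover have "?K \<in> null_sets leb"
    using finA fin\<Omega> by (intro null_sets_UN' kink_set_null) (auto intro: countable_finite countable_rat)
  ultimately have "?S \<union> ?T \<union> ?K \<in> null_sets leb" by blast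
  moreover have "{e \<in> space leb. \<not> generic e} = ?S \<union> ?T \<union> ?K"
  proof -
    have ties: "{e \<in> X. \<not> (\<forall>x\<in>I. \<forall>a\<in>A. \<forall>b\<in>A. a \<noteq> b \<longrightarrow> f e x a \<noteq> f e x b)}
        = (\<Union>x\<in>I. \<Union>a\<in>A. \<Union>b\<in>{b\<in>A. a \<noteq> b}. {e \<in> X. f e x a = f e x b})"
      for X :: "'x set" and I :: "'y set" and f :: "'x \<Rightarrow> 'y \<Rightarrow> 'a \<Rightarrow> real" by blast
    have "{e \<in> space leb. \<not> strict_sender e} = ?S"
      unfolding strict_sender_def by (rule ties)
    moreover have "{e \<in> space leb. \<not> no_receiver_ties e} = ?T"
      unfolding no_receiver_ties_def by (rule ties)
    moreover have "{e \<in> space leb. \<exists>a\<in>A. \<exists>w\<in>\<Omega>. \<exists>q\<in>\<rat>. e \<in> kink_set a w q} = ?K"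
      by (auto simp: kink_set_def)
    moreover have "{e \<in> space leb. \<not> generic e} = {e \<in> space leb. \<not> strict_sender e}
       \<union> {e \<in> space leb. \<not> no_receiver_ties e} \<union> {e \<in> space leb. \<exists>a\<in>A. \<exists>w\<in>\<Omega>. \<exists>q\<in>\<rat>. e \<in> kink_set a w q}"
      unfolding generic_def by blast
    ultimately show ?thesis by simp
  qed
  ultimately show ?thesis by simp
qed

abbreviation "cube \<equiv> index \<rightarrow>\<^sub>E {0..1::real}"

lemma emeasure_box:
  assumes "\<And>i. i \<in> index \<Longrightarrow> l i \<le> u i" and B: "\<And>i. i \<in> index \<Longrightarrow> B i = {l i..u i} \<or> B i = {l i<..u i}"
  shows "emeasure leb (PiE index B) = ennreal (\<Prod>i\<in>index. u i - l i)"
proof -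
  have "emeasure leb (PiE index B) = (\<Prod>i\<in>index. emeasure lborel (B i))"
    unfolding env_lebesgue_def
  proof (rule lb.emeasure_PiM[OF finite_index])
    show "B i \<in> sets lborel" if "i \<in> index" for i using B[OF that] by auto
  qed
  also have "\<dots> = (\<Prod>i\<in>index. ennreal (u i - l i))"
  proof (rule prod.cong[OF refl])
    show "emeasure lborel (B i) = ennreal (u i - l i)" if "i \<in> index" for i
      using B[OF that] assms(1)[OF that] by auto
  qed
  also have "\<dots> = ennreal (\<Prod>i\<in>index. u i - l i)"
    using assms by (intro prod_ennreal) simp
  finally show ?thesis .
qed

lemma emeasure_cube: "emeasure leb cube = 1"
  using emeasure_box[of "\<lambda>_. 0" "\<lambda>_. 1" "\<lambda>_. {0..1}"] by simp

lemma measure_cube: "measure leb cube = 1"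
  by (simp add: measure_def emeasure_cube)

lemma cube_fmeasurable: "cube \<in> fmeasurable leb"
  by (rule fmeasurableI) (use cube_measurable emeasure_cube in auto)

lemma fmeasurable_subset_cube: "S \<in> sets leb \<Longrightarrow> S \<subseteq> cube \<Longrightarrow> S \<in> fmeasurable leb"
  using cube_fmeasurable by (rule fmeasurableI2)

lemma measure_eq_generic:
  assumes "S \<in> sets leb" "S \<subseteq> cube"
  shows "{e \<in> S. generic e} \<in> sets leb" "measure leb {e \<in> S. generic e} = measure leb S"
proof -
  have eq: "{e \<in> S. generic e} = S - {e \<in> space leb. \<not> generic e}"
    using sets.sets_into_space[OF assms(1)] by auto
  show "{e \<in> S. generic e} \<in> sets leb" unfolding eq using assms nongeneric_null by auto
  show "measure leb {e \<in> S. generic e} = measure leb S"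
    unfolding eq by (rule measure_Diff_null_set) (use assms nongeneric_null in auto)
qed

section \<open>Reply maps and the symmetry between them\<close>

text \<open>\<beta> records Sender's favourite in every state. Once it is fixed, the announcement
  cells no longer vary with \<open>e\<close>, and a permutation of coordinates can be chosen to suit
  them.\<close>

definition reply_cell :: "('a \<Rightarrow> 'a) \<Rightarrow> ('w \<Rightarrow> 'a) \<Rightarrow> (bool \<times> 'a \<times> 'w \<Rightarrow> real) set" where
  "reply_cell r \<beta> = {e \<in> cube. strict_sender e \<and> (\<forall>w\<in>\<Omega>. is_best e w (\<beta> w)) \<and>
     (\<forall>a\<in>A. \<forall>b\<in>A. (\<Sum>w\<in>{w\<in>\<Omega>. \<beta> w = a}. \<mu>0 w * uR e b w) \<le> (\<Sum>w\<in>{w\<in>\<Omega>. \<beta> w = a}. \<mu>0 w * uR e (r a) w))}"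

lemma reply_cell_measurable:
  assumes r: "\<And>a. a \<in> A \<Longrightarrow> r a \<in> A" and \<beta>: "\<And>w. w \<in> \<Omega> \<Longrightarrow> \<beta> w \<in> A"
  shows "reply_cell r \<beta> \<in> sets leb"
proof -
  have sm: "(\<lambda>e. \<Sum>w\<in>{w\<in>\<Omega>. \<beta> w = a}. \<mu>0 w * uR e x w) \<in> borel_measurable leb" if "x \<in> A" for x a
    using that by (intro borel_measurable_sum borel_measurable_times component_measurable) auto
  have "{e \<in> space leb. strict_sender e \<and> (\<forall>w\<in>\<Omega>. is_best e w (\<beta> w)) \<and>
     (\<forall>a\<in>A. \<forall>b\<in>A. (\<Sum>w\<in>{w\<in>\<Omega>. \<beta> w = a}. \<mu>0 w * uR e b w) \<le> (\<Sum>w\<in>{w\<in>\<Omega>. \<beta> w = a}. \<mu>0 w * uR e (r a) w))} \<in> sets leb"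
    unfolding strict_sender_def is_best_def
    by (intro sets.sets_Collect_conj sets.sets_Collect_finite_All' sets.sets_Collect_imp sets.sets_Collect_const
       sets.sets_Collect_neg borel_measurable_le borel_measurable_eq component_measurable sm finA fin\<Omega> neA ne\<Omega> r \<beta>) auto
  then have "cube \<inter> {e \<in> space leb. strict_sender e \<and> (\<forall>w\<in>\<Omega>. is_best e w (\<beta> w)) \<and>
     (\<forall>a\<in>A. \<forall>b\<in>A. (\<Sum>w\<in>{w\<in>\<Omega>. \<beta> w = a}. \<mu>0 w * uR e b w) \<le> (\<Sum>w\<in>{w\<in>\<Omega>. \<beta> w = a}. \<mu>0 w * uR e (r a) w))} \<in> sets leb"
    by (intro sets.Int cube_measurable)
  also have "cube \<inter> {e \<in> space leb. strict_sender e \<and> (\<forall>w\<in>\<Omega>. is_best e w (\<beta> w)) \<and>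
     (\<forall>a\<in>A. \<forall>b\<in>A. (\<Sum>w\<in>{w\<in>\<Omega>. \<beta> w = a}. \<mu>0 w * uR e b w) \<le> (\<Sum>w\<in>{w\<in>\<Omega>. \<beta> w = a}. \<mu>0 w * uR e (r a) w))} = reply_cell r \<beta>"
    using sets.sets_into_space[OF cube_measurable] by (auto simp: reply_cell_def)
  finally show ?thesis .
qed

text \<open>In every state \<open>w\<close>, swapping Receiver's utilities from \<open>\<beta> w\<close> and \<open>r (\<beta> w)\<close> is a permutation of
  the coordinates that turns the one cell into the other.\<close>
lemma measure_reply_cell:
  assumes r: "\<And>a. a \<in> A \<Longrightarrow> r a \<in> A" and \<beta>: "\<And>w. w \<in> \<Omega> \<Longrightarrow> \<beta> w \<in> A"
  shows "measure leb (reply_cell r \<beta>) = measure leb (reply_cell (\<lambda>a. a) \<beta>)"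
proof -
  define \<tau> where "\<tau> w = Transposition.transpose (\<beta> w) (r (\<beta> w))" for w
  define f where "f = (\<lambda>(s, a, w). (s, if s then a else \<tau> w a, w))"
  have \<tau>A: "\<tau> w a \<in> A \<longleftrightarrow> a \<in> A" if "w \<in> \<Omega>" for w a
    using r[OF \<beta>[OF that]] \<beta>[OF that] by (auto simp: \<tau>_def Transposition.transpose_def)
  have \<tau>\<tau>: "\<tau> w (\<tau> w a) = a" for w a by (simp add: \<tau>_def)
  have ff: "f (f i) = i" for i by (cases i) (simp add: f_def \<tau>\<tau>)
  have fI: "f i \<in> index" if "i \<in> index" for i using that \<tau>A by (cases i) (auto simp: f_def)
  have bij: "bij_betw f index index"
    by (rule bij_betw_byWitness[where f' = f]) (use ff fI in auto)
  define T where "T e = (\<lambda>i\<in>index. e (f i))" for e :: "bool \<times> 'a \<times> 'w \<Rightarrow> real"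
  have distr: "distr leb leb T = leb"
    unfolding env_lebesgue_def T_def by (rule distr_PiM_lborel_permute[OF finite_index bij])
  have mT: "T \<in> measurable leb leb"
    unfolding env_lebesgue_def T_def by (intro measurable_restrict measurable_component_singleton fI)
  have TS: "uS (T e) a w = uS e a w" if "a \<in> A" "w \<in> \<Omega>" for e a w using that by (simp add: T_def f_def)
  have TR: "uR (T e) a w = uR e (\<tau> w a) w" if "a \<in> A" "w \<in> \<Omega>" for e a w using that by (simp add: T_def f_def)
  have Tcube: "T e \<in> cube \<longleftrightarrow> e \<in> cube" if "e \<in> space leb" for e
  proof -
    have "(\<forall>i\<in>index. 0 \<le> e (f i) \<and> e (f i) \<le> 1) \<longleftrightarrow> (\<forall>i\<in>index. 0 \<le> e i \<and> e i \<le> 1)"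
      using fI ff by metis
    then show ?thesis using that by (simp add: T_def PiE_iff space_leb)
  qed
  have Tstrict: "strict_sender (T e) \<longleftrightarrow> strict_sender e" for e by (simp add: strict_sender_def TS)
  have Tbest: "is_best (T e) w a \<longleftrightarrow> is_best e w a" if "w \<in> \<Omega>" for e w a using that by (auto simp: is_best_def TS)
  \<comment> \<open>All states of the cell have \<beta> w = a and hence the same transposition, so
    swapping coordinates swaps the aggregate utilities of \<open>a\<close> and
    \<open>r a\<close>.\<close>
  have Tsum: "(\<Sum>w\<in>{w\<in>\<Omega>. \<beta> w = a}. \<mu>0 w * uR (T e) b w)
      = (\<Sum>w\<in>{w\<in>\<Omega>. \<beta> w = a}. \<mu>0 w * uR e (Transposition.transpose a (r a) b) w)" if "b \<in> A" for e a b
    using that by (intro sum.cong refl) (auto simp: TR \<tau>_def)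
  have Treply: "(\<forall>b\<in>A. (\<Sum>w\<in>{w\<in>\<Omega>. \<beta> w = a}. \<mu>0 w * uR (T e) b w) \<le> (\<Sum>w\<in>{w\<in>\<Omega>. \<beta> w = a}. \<mu>0 w * uR (T e) (r a) w))
     \<longleftrightarrow> (\<forall>b\<in>A. (\<Sum>w\<in>{w\<in>\<Omega>. \<beta> w = a}. \<mu>0 w * uR e b w) \<le> (\<Sum>w\<in>{w\<in>\<Omega>. \<beta> w = a}. \<mu>0 w * uR e a w))"
    if a: "a \<in> A" for e a
  proof -
    let ?t = "Transposition.transpose a (r a)"
    have tA: "?t b \<in> A" if "b \<in> A" for b using that a r[OF a] by (auto simp: Transposition.transpose_def)
    have tt: "?t (?t b) = b" for b by simp
    have "(\<forall>b\<in>A. Q (?t b)) \<longleftrightarrow> (\<forall>b\<in>A. Q b)" for Q using tA tt by metis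
    then show ?thesis using r[OF a] by (simp add: Tsum)
  qed
  have pre: "T -` reply_cell r \<beta> \<inter> space leb = reply_cell (\<lambda>a. a) \<beta>"
  proof (rule set_eqI)
    fix e
    have "e \<in> T -` reply_cell r \<beta> \<inter> space leb \<longleftrightarrow> e \<in> space leb \<and> e \<in> reply_cell (\<lambda>a. a) \<beta>"
      unfolding reply_cell_def vimage_def Int_iff mem_Collect_eq
      using Tcube[of e] Tstrict[of e] Tbest Treply by blast
    then show "e \<in> T -` reply_cell r \<beta> \<inter> space leb \<longleftrightarrow> e \<in> reply_cell (\<lambda>a. a) \<beta>"
      using sets.sets_into_space[OF cube_measurable] by (auto simp: reply_cell_def)
  qed
  have "measure leb (reply_cell r \<beta>) = measure (distr leb leb T) (reply_cell r \<beta>)" by (simp add: distr)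
  also have "\<dots> = measure leb (T -` reply_cell r \<beta> \<inter> space leb)"
    by (rule measure_distr[OF mT reply_cell_measurable]) (use r \<beta> in auto)
  finally show ?thesis by (simp add: pre)
qed

lemma reply_cell_subset_cube: "reply_cell r \<beta> \<subseteq> cube"
  by (auto simp: reply_cell_def)

lemma reply_cells_disjoint:
  assumes "B \<subseteq> \<Omega> \<rightarrow>\<^sub>E A" shows "disjoint_family_on (reply_cell r) B"
proof -
  have "\<beta> = \<gamma>" if "e \<in> reply_cell r \<beta>" "e \<in> reply_cell r \<gamma>" "\<beta> \<in> B" "\<gamma> \<in> B" for e \<beta> \<gamma>
  proof (rule PiE_ext)
    show "\<beta> \<in> \<Omega> \<rightarrow>\<^sub>E A" "\<gamma> \<in> \<Omega> \<rightarrow>\<^sub>E A" using that assms by auto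
    show "\<beta> w = \<gamma> w" if "w \<in> \<Omega>" for w
      using is_best_unique[of e w] \<open>e \<in> reply_cell r \<beta>\<close> \<open>e \<in> reply_cell r \<gamma>\<close> that by (auto simp: reply_cell_def)
  qed
  then show ?thesis unfolding disjoint_family_on_def by blast
qed

text \<open>\<open>B\<close> is used twice: as the set of all maps for the covering family, and as
  the set of surjections for the disjoint one.\<close>

lemma measure_UN_reply_cells:
  assumes B: "B \<subseteq> \<Omega> \<rightarrow>\<^sub>E A" and r: "\<And>a. a \<in> A \<Longrightarrow> r a \<in> A"
  shows "(\<Union>\<beta>\<in>B. reply_cell r \<beta>) \<in> sets leb"
    and "measure leb (\<Union>\<beta>\<in>B. reply_cell r \<beta>) = measure leb (\<Union>\<beta>\<in>B. reply_cell (\<lambda>a. a) \<beta>)"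
proof -
  have \<beta>A: "\<beta> w \<in> A" if "\<beta> \<in> B" "w \<in> \<Omega>" for \<beta> w using that B by auto
  have finB: "finite B" using B finA fin\<Omega> finite_PiE finite_subset by metis
  have sets: "reply_cell r \<beta> \<in> sets leb" if "\<beta> \<in> B" "\<And>a. a \<in> A \<Longrightarrow> r a \<in> A" for r \<beta>
    using reply_cell_measurable[of r \<beta>] \<beta>A that by blast
  show "(\<Union>\<beta>\<in>B. reply_cell r \<beta>) \<in> sets leb" using finB sets[OF _ r] by auto
  have sum: "measure leb (\<Union>\<beta>\<in>B. reply_cell r \<beta>) = (\<Sum>\<beta>\<in>B. measure leb (reply_cell r \<beta>))"
    if r: "\<And>a. a \<in> A \<Longrightarrow> r a \<in> A" for r
  proof (rule measure_finite_Union[OF finB])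
    show "reply_cell r ` B \<subseteq> sets leb" using sets[OF _ r] by auto
    show "emeasure leb (reply_cell r \<beta>) \<noteq> \<infinity>" if "\<beta> \<in> B" for \<beta>
      using fmeasurableD2[OF fmeasurable_subset_cube[OF sets[OF that r] reply_cell_subset_cube]] by simp
  qed (rule reply_cells_disjoint[OF B])
  have "measure leb (reply_cell r \<beta>) = measure leb (reply_cell (\<lambda>a. a) \<beta>)" if "\<beta> \<in> B" for \<beta>
    by (rule measure_reply_cell) (use r \<beta>A that in auto)
  then show "measure leb (\<Union>\<beta>\<in>B. reply_cell r \<beta>) = measure leb (\<Union>\<beta>\<in>B. reply_cell (\<lambda>a. a) \<beta>)"
    using sum[OF r] sum[of "\<lambda>a. a"] by simp
qed

text \<open>Without Sender ties, \<open>e\<close> determines \<beta>, so a union over \<beta>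
  forgets it; surjectivity of \<beta> says that every announcement occurs.\<close>

lemma reply_cells_iff:
  assumes "e \<in> cube" "strict_sender e"
  shows "e \<in> (\<Union>\<beta>\<in>\<Omega> \<rightarrow>\<^sub>E A. reply_cell r \<beta>) \<longleftrightarrow> replies r e"
    and "e \<in> (\<Union>\<beta>\<in>{\<beta> \<in> \<Omega> \<rightarrow>\<^sub>E A. \<beta> ` \<Omega> = A}. reply_cell r \<beta>)
      \<longleftrightarrow> replies r e \<and> (\<forall>a\<in>A. \<exists>w\<in>\<Omega>. is_best e w a)"
proof -
  obtain c where c: "\<And>w. is_best e w (c w)" using ex_is_best by metis
  have c': "restrict c \<Omega> \<in> \<Omega> \<rightarrow>\<^sub>E A" using c by (auto simp: is_best_def)
  have cell: "{w\<in>\<Omega>. restrict c \<Omega> w = a} = {w\<in>\<Omega>. is_best e w a}" for a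
    using c is_best_unique[OF assms(2)] by auto
  have *: "e \<in> reply_cell r \<beta> \<longleftrightarrow> \<beta> = restrict c \<Omega> \<and> replies r e" if "\<beta> \<in> \<Omega> \<rightarrow>\<^sub>E A" for \<beta>
  proof
    assume e: "e \<in> reply_cell r \<beta>"
    have "\<beta> = restrict c \<Omega>"
    proof (rule PiE_ext[OF that c'])
      show "\<beta> w = restrict c \<Omega> w" if "w \<in> \<Omega>" for w
        using e c that is_best_unique[OF assms(2) that, of "\<beta> w" "c w"] by (simp add: reply_cell_def)
    qed
    moreover have "e \<in> reply_cell r (restrict c \<Omega>)" using e calculation by simp
    then have "replies r e" unfolding reply_cell_def replies_def cell mem_Collect_eq by blast
    ultimately show "\<beta> = restrict c \<Omega> \<and> replies r e" by blast
  next
    assume *: "\<beta> = restrict c \<Omega> \<and> replies r e"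
    have "is_best e w (restrict c \<Omega> w)" if "w \<in> \<Omega>" for w using c that by simp
    then have "e \<in> reply_cell r (restrict c \<Omega>)"
      using * assms unfolding reply_cell_def replies_def cell mem_Collect_eq by blast
    then show "e \<in> reply_cell r \<beta>" using * by simp
  qed
  then show "e \<in> (\<Union>\<beta>\<in>\<Omega> \<rightarrow>\<^sub>E A. reply_cell r \<beta>) \<longleftrightarrow> replies r e" using c' by blast
  have "restrict c \<Omega> ` \<Omega> = A \<longleftrightarrow> (\<forall>a\<in>A. \<exists>w\<in>\<Omega>. is_best e w a)"
  proof
    assume A: "restrict c \<Omega> ` \<Omega> = A"
    show "\<forall>a\<in>A. \<exists>w\<in>\<Omega>. is_best e w a"
    proof
      fix a assume "a \<in> A"
      then obtain w where "w \<in> \<Omega>" "a = c w" using A by auto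
      then show "\<exists>w\<in>\<Omega>. is_best e w a" using c by blast
    qed
  next
    assume *: "\<forall>a\<in>A. \<exists>w\<in>\<Omega>. is_best e w a"
    have "a \<in> restrict c \<Omega> ` \<Omega>" if aA: "a \<in> A" for a
    proof -
      obtain w where w: "w \<in> \<Omega>" "is_best e w a" using * aA by blast
      then have "a = restrict c \<Omega> w" using is_best_unique[OF assms(2) w(1) w(2) c] by simp
      then show ?thesis using w(1) by (rule image_eqI)
    qed
    then have "A \<subseteq> restrict c \<Omega> ` \<Omega>" by (rule subsetI)
    moreover have "restrict c \<Omega> ` \<Omega> \<subseteq> A" using c' by auto
    ultimately show "restrict c \<Omega> ` \<Omega> = A" by (rule subset_antisym[rotated])
  qed
  then show "e \<in> (\<Union>\<beta>\<in>{\<beta> \<in> \<Omega> \<rightarrow>\<^sub>E A. \<beta> ` \<Omega> = A}. reply_cell r \<beta>)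
      \<longleftrightarrow> replies r e \<and> (\<forall>a\<in>A. \<exists>w\<in>\<Omega>. is_best e w a)"
    using * c' by blast
qed

lemma ex_replies: "\<exists>r\<in>A \<rightarrow>\<^sub>E A. replies r e"
proof -
  have ex: "\<exists>b\<in>A. \<forall>d\<in>A. f d \<le> f b" for f :: "'a \<Rightarrow> real"
  proof -
    have "Max (f ` A) \<in> f ` A" using finA neA by simp
    then obtain b where b: "b \<in> A" "f b = Max (f ` A)" by auto
    then show ?thesis using finA by (intro bexI[of _ b]) auto
  qed
  define F where "F a b = (\<Sum>w\<in>{w\<in>\<Omega>. is_best e w a}. \<mu>0 w * uR e b w)" for a b
  have "\<forall>a. \<exists>b. b \<in> A \<and> (\<forall>d\<in>A. F a d \<le> F a b)" using ex by blast
  then obtain r where r: "\<And>a. r a \<in> A" "\<And>a d. d \<in> A \<Longrightarrow> F a d \<le> F a (r a)" by metis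
  have "replies (restrict r A) e" using r(2) unfolding replies_def F_def by simp
  moreover have "restrict r A \<in> A \<rightarrow>\<^sub>E A" using r(1) by auto
  ultimately show ?thesis by blast
qed

definition reply_set :: "('a \<Rightarrow> 'a) \<Rightarrow> (bool \<times> 'a \<times> 'w \<Rightarrow> real) set" where
  "reply_set r = (\<Union>\<beta>\<in>\<Omega> \<rightarrow>\<^sub>E A. reply_cell r \<beta>)"

definition full_reply_set :: "('a \<Rightarrow> 'a) \<Rightarrow> (bool \<times> 'a \<times> 'w \<Rightarrow> real) set" where
  "full_reply_set r = (\<Union>\<beta>\<in>{\<beta> \<in> \<Omega> \<rightarrow>\<^sub>E A. \<beta> ` \<Omega> = A}. reply_cell r \<beta>)"

lemma card_replies: "card (A \<rightarrow>\<^sub>E A) = card A ^ card A" and finite_replies: "finite (A \<rightarrow>\<^sub>E A)"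
  using finA by (auto simp: card_PiE finite_PiE)

lemma reply_set_subset_cube: "reply_set r \<subseteq> cube" "full_reply_set r \<subseteq> cube"
  using reply_cell_subset_cube by (auto simp: reply_set_def full_reply_set_def)

lemma reply_set_measurable:
  assumes "\<And>a. a \<in> A \<Longrightarrow> r a \<in> A"
  shows "reply_set r \<in> sets leb" "full_reply_set r \<in> sets leb"
  unfolding reply_set_def full_reply_set_def by (rule measure_UN_reply_cells; use assms in auto)+

lemma measure_reply_set:
  assumes "\<And>a. a \<in> A \<Longrightarrow> r a \<in> A"
  shows "measure leb (reply_set r) = measure leb (reply_set (\<lambda>a. a))"
    "measure leb (full_reply_set r) = measure leb (full_reply_set (\<lambda>a. a))"
  unfolding reply_set_def full_reply_set_def by (rule measure_UN_reply_cells; use assms in auto)+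

text \<open>An optimal reply to each announcement always exists, so the reply sets cover almost all
  of the cube, and they have equal measure. Overlaps do no harm in this direction.\<close>

lemma measure_reply_set_ge: "1 / real (card A ^ card A) \<le> measure leb (reply_set (\<lambda>a. a))"
proof -
  have rA: "r a \<in> A" if "r \<in> A \<rightarrow>\<^sub>E A" "a \<in> A" for r a using that by auto
  have sets: "reply_set r \<in> sets leb" if "r \<in> A \<rightarrow>\<^sub>E A" for r
    by (rule reply_set_measurable) (use rA that in auto)
  have U: "(\<Union>r\<in>A \<rightarrow>\<^sub>E A. reply_set r) \<in> sets leb" using finite_replies sets by auto
  have sub: "{e \<in> cube. generic e} \<subseteq> (\<Union>r\<in>A \<rightarrow>\<^sub>E A. reply_set r)"
  proof
    fix e assume "e \<in> {e \<in> cube. generic e}"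
    then have e: "e \<in> cube" "strict_sender e" by (auto simp: generic_def)
    obtain r where "r \<in> A \<rightarrow>\<^sub>E A" "replies r e" using ex_replies by blast
    then show "e \<in> (\<Union>r\<in>A \<rightarrow>\<^sub>E A. reply_set r)"
      using reply_cells_iff(1)[OF e, of r] unfolding reply_set_def by blast
  qed
  have "1 = measure leb {e \<in> cube. generic e}"
    using measure_eq_generic(2)[OF cube_measurable subset_refl] measure_cube by simp
  also have "\<dots> \<le> measure leb (\<Union>r\<in>A \<rightarrow>\<^sub>E A. reply_set r)"
    using measure_eq_generic(1)[OF cube_measurable subset_refl] U reply_set_subset_cube(1)
    by (intro measure_mono_fmeasurable[OF sub] fmeasurable_subset_cube) auto
  also have "\<dots> \<le> (\<Sum>r\<in>A \<rightarrow>\<^sub>E A. measure leb (reply_set r))"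
    by (rule measure_UNION_le[OF finite_replies]) (rule sets)
  also have "\<dots> = (\<Sum>r\<in>A \<rightarrow>\<^sub>E A. measure leb (reply_set (\<lambda>a. a)))"
    by (intro sum.cong refl measure_reply_set) (use rA in auto)
  finally have "1 \<le> real (card A ^ card A) * measure leb (reply_set (\<lambda>a. a))"
    by (simp add: card_replies)
  moreover have "0 < real (card A ^ card A)" using finA neA by (simp add: card_gt_0_iff)
  ultimately show ?thesis by (simp add: divide_le_eq mult.commute)
qed

text \<open>Every announcement cell is nonempty and Receiver has no ties on it, so each optimal
  reply, and thus \<open>r\<close>, is unique.\<close>

lemma full_reply_sets_disjoint:
  "disjoint_family_on (\<lambda>r. {e \<in> full_reply_set r. generic e}) (A \<rightarrow>\<^sub>E A)"
proof -
  have "r = r'" if r: "r \<in> A \<rightarrow>\<^sub>E A" "r' \<in> A \<rightarrow>\<^sub>E A" and e: "e \<in> full_reply_set r" "e \<in> full_reply_set r'" "generic e" for r r' e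
  proof (rule PiE_ext[OF r])
    have S: "e \<in> cube" "strict_sender e" using e reply_set_subset_cube(2) by (auto simp: generic_def)
    have R: "replies r e" "replies r' e" and full: "\<And>a. a \<in> A \<Longrightarrow> \<exists>w\<in>\<Omega>. is_best e w a"
      using e(1,2) reply_cells_iff(2)[OF S] unfolding full_reply_set_def by blast+
    fix a assume a: "a \<in> A"
    let ?W = "{w\<in>\<Omega>. is_best e w a}"
    have ra: "r a \<in> A" "r' a \<in> A" using r a by auto
    have "(\<Sum>w\<in>?W. \<mu>0 w * uR e (r a) w) = (\<Sum>w\<in>?W. \<mu>0 w * uR e (r' a) w)"
      by (rule antisym) (use R a ra in \<open>auto simp: replies_def\<close>)
    moreover have W: "?W \<in> Pow \<Omega> - {{}}" using full[OF a] by auto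
    have "no_receiver_ties e" using e(3) by (simp add: generic_def)
    then have "\<forall>a\<in>A. \<forall>b\<in>A. a \<noteq> b \<longrightarrow> (\<Sum>w\<in>?W. \<mu>0 w * uR e a w) \<noteq> (\<Sum>w\<in>?W. \<mu>0 w * uR e b w)"
      unfolding no_receiver_ties_def by (rule bspec[OF _ W])
    ultimately show "r a = r' a" using ra by blast
  qed
  then show ?thesis unfolding disjoint_family_on_def by blast
qed

lemma measure_full_reply_set_le: "measure leb (full_reply_set (\<lambda>a. a)) \<le> 1 / real (card A ^ card A)"
proof -
  have rA: "r a \<in> A" if "r \<in> A \<rightarrow>\<^sub>E A" "a \<in> A" for r a using that by auto
  have sets: "full_reply_set r \<in> sets leb" if "r \<in> A \<rightarrow>\<^sub>E A" for r
    by (rule reply_set_measurable) (use rA that in auto)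
  note gen = measure_eq_generic[OF sets reply_set_subset_cube(2)]
  have "real (card A ^ card A) * measure leb (full_reply_set (\<lambda>a. a))
      = (\<Sum>r\<in>A \<rightarrow>\<^sub>E A. measure leb (full_reply_set (\<lambda>a. a)))" by (simp add: card_replies)
  also have "\<dots> = (\<Sum>r\<in>A \<rightarrow>\<^sub>E A. measure leb {e \<in> full_reply_set r. generic e})"
  proof (rule sum.cong[OF refl])
    fix r assume r: "r \<in> A \<rightarrow>\<^sub>E A"
    show "measure leb (full_reply_set (\<lambda>a. a)) = measure leb {e \<in> full_reply_set r. generic e}"
      using measure_reply_set(2)[of r] rA[OF r] gen(2)[OF r] by simp
  qed
  also have "\<dots> = measure leb (\<Union>r\<in>A \<rightarrow>\<^sub>E A. {e \<in> full_reply_set r. generic e})"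
  proof (rule measure_finite_Union[OF finite_replies _ full_reply_sets_disjoint, symmetric])
    show "(\<lambda>r. {e \<in> full_reply_set r. generic e}) ` (A \<rightarrow>\<^sub>E A) \<subseteq> sets leb" using gen(1) by auto
    show "emeasure leb {e \<in> full_reply_set r. generic e} \<noteq> \<infinity>" if "r \<in> A \<rightarrow>\<^sub>E A" for r
    proof -
      have "{e \<in> full_reply_set r. generic e} \<in> fmeasurable leb"
        using gen(1)[OF that] reply_set_subset_cube(2) by (intro fmeasurable_subset_cube) auto
      then show ?thesis using fmeasurableD2 by force
    qed
  qed
  also have "\<dots> \<le> measure leb cube"
  proof (rule measure_mono_fmeasurable[OF _ _ cube_fmeasurable])
    show "(\<Union>r\<in>A \<rightarrow>\<^sub>E A. {e \<in> full_reply_set r. generic e}) \<subseteq> cube" using reply_set_subset_cube(2) by blast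
    show "(\<Union>r\<in>A \<rightarrow>\<^sub>E A. {e \<in> full_reply_set r. generic e}) \<in> sets leb" using finite_replies gen(1) by auto
  qed
  finally have "real (card A ^ card A) * measure leb (full_reply_set (\<lambda>a. a)) \<le> 1" by (simp add: measure_cube)
  moreover have "0 < real (card A ^ card A)" using finA neA by (simp add: card_gt_0_iff)
  ultimately show ?thesis by (simp add: le_divide_eq mult.commute)
qed

text \<open>An environment is coarsened to the pattern of utilities exceeding \<open>1/2\<close>; these patterns are
  equidistributed, and a state in which both players rank only \<open>b\<close> high is aligned.\<close>
definition pattern_box :: "('w \<Rightarrow> bool \<times> 'a \<Rightarrow> bool) \<Rightarrow> (bool \<times> 'a \<times> 'w \<Rightarrow> real) set" where
  "pattern_box t = PiE index (\<lambda>(s, a, w). if t w (s, a) then {1/2<..1} else {0..1/2})"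

definition unaligned_patterns :: "'a \<Rightarrow> ('w \<Rightarrow> bool \<times> 'a \<Rightarrow> bool) set" where
  "unaligned_patterns b = (\<Omega> \<rightarrow>\<^sub>E ((UNIV \<times> A \<rightarrow>\<^sub>E UNIV) - {\<lambda>p\<in>UNIV \<times> A. snd p = b}))"

lemma card_index: "card index = 2 * card A * card \<Omega>"
  using finA fin\<Omega> by (simp add: env_index_def card_cartesian_product)

lemma emeasure_pattern_box: "emeasure leb (pattern_box t) = ennreal ((1/2) ^ (2 * card A * card \<Omega>))"
proof -
  have "emeasure leb (pattern_box t) = ennreal (\<Prod>i\<in>index.
      (case i of (s, a, w) \<Rightarrow> if t w (s, a) then 1 else 1/2) - (case i of (s, a, w) \<Rightarrow> if t w (s, a) then 1/2 else 0))"
    unfolding pattern_box_def by (rule emeasure_box) (auto split: prod.splits)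
  also have "(\<Prod>i\<in>index. (case i of (s, a, w) \<Rightarrow> if t w (s, a) then 1 else 1/2)
      - (case i of (s, a, w) \<Rightarrow> if t w (s, a) then 1/2 else 0)) = (\<Prod>i\<in>index. 1/2 :: real)"
    by (intro prod.cong refl) (auto split: prod.splits)
  finally show ?thesis by (simp add: card_index)
qed

lemma pattern_box_measurable: "pattern_box t \<in> sets leb"
  unfolding pattern_box_def env_lebesgue_def
  using finite_index by (intro sets_PiM_I_finite) (auto split: prod.splits)

text \<open>A state has 2|A| utilities, hence 2^(2|A|) patterns. In each state exactly one is
  forbidden, and the choices for different states are independent.\<close>

lemma card_unaligned_patterns:
  assumes "b \<in> A"
  shows "finite (unaligned_patterns b)"
    and "card (unaligned_patterns b) = (2 ^ (2 * card A) - 1) ^ card \<Omega>"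
proof -
  have f: "finite ((UNIV \<times> A \<rightarrow>\<^sub>E UNIV) :: (bool \<times> 'a \<Rightarrow> bool) set)" using finA by (intro finite_PiE) auto
  then show "finite (unaligned_patterns b)" unfolding unaligned_patterns_def using fin\<Omega> by (intro finite_PiE) auto
  have "card ((UNIV \<times> A \<rightarrow>\<^sub>E UNIV) :: (bool \<times> 'a \<Rightarrow> bool) set) = 2 ^ (2 * card A)"
    using finA by (simp add: card_PiE card_cartesian_product)
  then have "card (((UNIV \<times> A \<rightarrow>\<^sub>E UNIV) :: (bool \<times> 'a \<Rightarrow> bool) set) - {\<lambda>p\<in>UNIV \<times> A. snd p = b}) = 2 ^ (2 * card A) - 1"
    using f by (subst card_Diff_singleton) auto
  then show "card (unaligned_patterns b) = (2 ^ (2 * card A) - 1) ^ card \<Omega>"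
    unfolding unaligned_patterns_def using fin\<Omega> by (simp add: card_PiE)
qed

lemma not_aligned_pattern_box:
  assumes e: "e \<in> cube" and na: "\<not> aligned_states e"
  shows "\<exists>b\<in>A. \<exists>t\<in>unaligned_patterns b. e \<in> pattern_box t"
proof -
  obtain b where b: "b \<in> A"
    and nb: "\<And>w. w \<in> \<Omega> \<Longrightarrow> \<not> (\<forall>a\<in>A - {b}. uS e a w < uS e b w \<and> uR e a w < uR e b w)"
    using na unfolding aligned_states_def by blast
  define t where "t = (\<lambda>w\<in>\<Omega>. \<lambda>p\<in>UNIV \<times> A. 1/2 < e (fst p, snd p, w))"
  have "t w \<noteq> (\<lambda>p\<in>UNIV \<times> A. snd p = b)" if w: "w \<in> \<Omega>" for w
  proof
    assume eq: "t w = (\<lambda>p\<in>UNIV \<times> A. snd p = b)"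
    have hi: "1/2 < e (s, a, w) \<longleftrightarrow> a = b" if "a \<in> A" for s a
      using fun_cong[OF eq, of "(s, a)"] that w by (simp add: t_def)
    have "uS e a w < uS e b w \<and> uR e a w < uR e b w" if "a \<in> A - {b}" for a
      using hi[OF b, of True] hi[OF b, of False] hi[of a True] hi[of a False] that by auto
    then show False using nb[OF w] by blast
  qed
  then have "t \<in> unaligned_patterns b" unfolding unaligned_patterns_def by (auto simp: t_def)
  moreover have "e \<in> pattern_box t"
    using e by (auto simp: pattern_box_def PiE_iff t_def)
  ultimately show ?thesis using b by blast
qed

lemma measure_unaligned:
  defines "U \<equiv> (\<Union>b\<in>A. \<Union>t\<in>unaligned_patterns b. pattern_box t)"
  shows "U \<in> sets leb"
    and "measure leb U \<le> card A * ((2 ^ (2 * card A) - 1) / 2 ^ (2 * card A)) ^ card \<Omega>"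
proof -
  have V: "(\<Union>t\<in>unaligned_patterns b. pattern_box t) \<in> sets leb" if "b \<in> A" for b
    using card_unaligned_patterns(1)[OF that] pattern_box_measurable by auto
  then show "U \<in> sets leb" unfolding U_def using finA by auto
  have "measure leb U \<le> (\<Sum>b\<in>A. measure leb (\<Union>t\<in>unaligned_patterns b. pattern_box t))"
    unfolding U_def by (rule measure_UNION_le[OF finA V])
  also have "\<dots> \<le> (\<Sum>b\<in>A. ((2 ^ (2 * card A) - 1) / 2 ^ (2 * card A)) ^ card \<Omega>)"
  proof (rule sum_mono)
    fix b assume b: "b \<in> A"
    have "measure leb (\<Union>t\<in>unaligned_patterns b. pattern_box t) \<le> (\<Sum>t\<in>unaligned_patterns b. measure leb (pattern_box t))"
      by (rule measure_UNION_le[OF card_unaligned_patterns(1)[OF b] pattern_box_measurable])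
    also have "\<dots> = real (card (unaligned_patterns b)) * (1/2) ^ (2 * card A * card \<Omega>)"
      by (simp add: measure_def emeasure_pattern_box)
    also have "\<dots> = ((2 ^ (2 * card A) - 1) / 2 ^ (2 * card A)) ^ card \<Omega>"
      by (simp add: card_unaligned_patterns(2)[OF b] of_nat_diff power_divide flip: power_mult)
    finally show "measure leb (\<Union>t\<in>unaligned_patterns b. pattern_box t) \<le> ((2 ^ (2 * card A) - 1) / 2 ^ (2 * card A)) ^ card \<Omega>" .
  qed
  finally show "measure leb U \<le> card A * ((2 ^ (2 * card A) - 1) / 2 ^ (2 * card A)) ^ card \<Omega>" by simp
qed

section \<open>The two bounds for a fixed state space\<close>

lemma no_value_set_subset_cube: "no_value_set A \<Omega> M \<mu>0 \<subseteq> cube"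
  by (auto simp: no_value_set_def)

lemma no_value_measure_ge: "1 / real (card A ^ card A) \<le> measure leb (no_value_set A \<Omega> M \<mu>0)"
proof -
  have "reply_set (\<lambda>a. a) \<subseteq> no_value_set A \<Omega> M \<mu>0"
  proof
    fix e assume e: "e \<in> reply_set (\<lambda>a. a)"
    then have S: "e \<in> cube" "strict_sender e" by (auto simp: reply_set_def reply_cell_def)
    then have "replies (\<lambda>a. a) e" using e reply_cells_iff(1)[OF S] unfolding reply_set_def by blast
    then show "e \<in> no_value_set A \<Omega> M \<mu>0"
      using favourites_replies_imp_no_value[OF S(2)] S(1) by (simp add: no_value_set_def)
  qed
  then have "measure leb (reply_set (\<lambda>a. a)) \<le> measure leb (no_value_set A \<Omega> M \<mu>0)"
    using no_value_set_subset_cube no_value_set_measurable reply_set_measurable(1)[of "\<lambda>a. a"]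
    by (intro measure_mono_fmeasurable fmeasurable_subset_cube) auto
  then show ?thesis using measure_reply_set_ge by simp
qed

text \<open>Up to a null set, an environment without value of commitment is either unaligned or lies
  in the full reply set of the identity, since an aligned state for \<open>b\<close> also makes
  \<open>b\<close> a favourite.\<close>

lemma no_value_measure_le:
  "measure leb (no_value_set A \<Omega> M \<mu>0) \<le> 1 / real (card A ^ card A)
     + card A * ((2 ^ (2 * card A) - 1) / 2 ^ (2 * card A)) ^ card \<Omega>"
proof -
  let ?U = "\<Union>b\<in>A. \<Union>t\<in>unaligned_patterns b. pattern_box t"
  let ?F = "full_reply_set (\<lambda>a. a)"
  have "{e \<in> no_value_set A \<Omega> M \<mu>0. generic e} \<subseteq> ?F \<union> ?U"
  proof
    fix e assume e: "e \<in> {e \<in> no_value_set A \<Omega> M \<mu>0. generic e}"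
    then have S: "e \<in> cube" "strict_sender e" and g: "generic e"
      and nv: "no_value_commitment A \<Omega> M \<mu>0 (uS e) (uR e)"
      by (auto simp: no_value_set_def generic_def)
    show "e \<in> ?F \<union> ?U"
    proof (cases "aligned_states e")
      case True
      have "e \<in> space leb" using S(1) sets.sets_into_space[OF cube_measurable] by blast
      then have "replies (\<lambda>a. a) e"
        using g True nv by (intro no_value_imp_favourites_replies) (auto simp: generic_def)
      moreover have "\<forall>a\<in>A. \<exists>w\<in>\<Omega>. is_best e w a"
      proof
        fix b assume b: "b \<in> A"
        then obtain w where w: "w \<in> \<Omega>" "\<forall>a\<in>A - {b}. uS e a w < uS e b w \<and> uR e a w < uR e b w"
          using True unfolding aligned_states_def by blast
        have "uS e a w \<le> uS e b w" if "a \<in> A" for a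
          using w(2) that by (cases "a = b") (auto simp: less_imp_le)
        then show "\<exists>w\<in>\<Omega>. is_best e w b" using w(1) b unfolding is_best_def by blast
      qed
      ultimately have "e \<in> ?F" using reply_cells_iff(2)[OF S] unfolding full_reply_set_def by blast
      then show ?thesis by blast
    next
      case False
      then show ?thesis using not_aligned_pattern_box[OF S(1)] by blast
    qed
  qed
  moreover have "?F \<union> ?U \<in> fmeasurable leb"
  proof (rule fmeasurable.Un)
    show "?F \<in> fmeasurable leb"
      using reply_set_measurable(2)[of "\<lambda>a. a"] reply_set_subset_cube(2) by (intro fmeasurable_subset_cube) auto
    have "pattern_box t \<subseteq> cube" for t
      unfolding pattern_box_def by (intro PiE_mono) (auto split: prod.splits if_splits)
    then show "?U \<in> fmeasurable leb" using measure_unaligned(1) by (intro fmeasurable_subset_cube) auto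
  qed
  ultimately have "measure leb {e \<in> no_value_set A \<Omega> M \<mu>0. generic e} \<le> measure leb (?F \<union> ?U)"
    using measure_eq_generic(1)[OF no_value_set_measurable no_value_set_subset_cube]
    by (intro measure_mono_fmeasurable) auto
  also have "\<dots> \<le> measure leb ?F + measure leb ?U"
    by (rule measure_Un_le) (use reply_set_measurable(2)[of "\<lambda>a. a"] measure_unaligned(1) in auto)
  finally show ?thesis
    using measure_eq_generic(2)[OF no_value_set_measurable no_value_set_subset_cube]
      measure_full_reply_set_le measure_unaligned(2) by linarith
qed

end

theorem theorem3:
  fixes A :: "'a set"
  assumes "finite A" and "A \<noteq> {}"
  shows
   "(\<forall>(\<Omega> :: 'w set) (\<mu>0 :: 'w \<Rightarrow> real) (M :: 'm set).
       finite \<Omega> \<and> \<Omega> \<noteq> {} \<and> is_prior \<Omega> \<mu>0 \<and> (\<forall>w\<in>\<Omega>. \<mu>0 w > 0) \<and>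
       finite M \<and> card M > max (card \<Omega>) (card A)
       \<longrightarrow> measure (env_lebesgue A \<Omega>) (no_value_set A \<Omega> M \<mu>0)
             \<ge> 1 / real (card A ^ card A))
    \<and>
    (\<forall>(\<Omega>s :: nat \<Rightarrow> 'w set) (\<mu>s :: nat \<Rightarrow> 'w \<Rightarrow> real) (Ms :: nat \<Rightarrow> 'm set).
       (\<forall>n. finite (\<Omega>s n) \<and> \<Omega>s n \<noteq> {} \<and> is_prior (\<Omega>s n) (\<mu>s n) \<and>
            (\<forall>w\<in>\<Omega>s n. \<mu>s n w > 0) \<and>
            finite (Ms n) \<and> card (Ms n) > max (card (\<Omega>s n)) (card A)) \<and>
       filterlim (\<lambda>n. card (\<Omega>s n)) at_top sequentially
       \<longrightarrow> (\<lambda>n. measure (env_lebesgue A (\<Omega>s n)) (no_value_set A (\<Omega>s n) (Ms n) (\<mu>s n)))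
             \<longlonglongrightarrow> 1 / real (card A ^ card A))"
proof -
  have game: "persuasion A \<Omega> M \<mu>0"
    if "finite \<Omega> \<and> \<Omega> \<noteq> {} \<and> is_prior \<Omega> \<mu>0 \<and> (\<forall>w\<in>\<Omega>. \<mu>0 w > 0) \<and>
       finite M \<and> card M > max (card \<Omega>) (card A)"
    for \<Omega> :: "'w set" and \<mu>0 and M :: "'m set"
    using that assms by (auto simp: persuasion_def is_prior_def)
  show ?thesis
  proof (intro conjI allI impI)
    fix \<Omega> :: "'w set" and \<mu>0 and M :: "'m set"
    assume "finite \<Omega> \<and> \<Omega> \<noteq> {} \<and> is_prior \<Omega> \<mu>0 \<and> (\<forall>w\<in>\<Omega>. \<mu>0 w > 0) \<and>
       finite M \<and> card M > max (card \<Omega>) (card A)"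
    from persuasion.no_value_measure_ge[OF game[OF this]]
    show "measure (env_lebesgue A \<Omega>) (no_value_set A \<Omega> M \<mu>0) \<ge> 1 / real (card A ^ card A)" .
  next
    fix \<Omega>s :: "nat \<Rightarrow> 'w set" and \<mu>s :: "nat \<Rightarrow> 'w \<Rightarrow> real" and Ms :: "nat \<Rightarrow> 'm set"
    assume *: "(\<forall>n. finite (\<Omega>s n) \<and> \<Omega>s n \<noteq> {} \<and> is_prior (\<Omega>s n) (\<mu>s n) \<and>
            (\<forall>w\<in>\<Omega>s n. \<mu>s n w > 0) \<and>
            finite (Ms n) \<and> card (Ms n) > max (card (\<Omega>s n)) (card A)) \<and>
       filterlim (\<lambda>n. card (\<Omega>s n)) at_top sequentially"
    then have g: "persuasion A (\<Omega>s n) (Ms n) (\<mu>s n)" for n by (intro game) blast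
    \<comment> \<open>The probability that a state misses the one pattern ensuring alignment for a
      given action.\<close>
    define \<theta> :: real where "\<theta> = (2 ^ (2 * card A) - 1) / 2 ^ (2 * card A)"
    have \<theta>: "0 \<le> \<theta>" "\<theta> < 1" by (auto simp: \<theta>_def divide_less_eq)
    show "(\<lambda>n. measure (env_lebesgue A (\<Omega>s n)) (no_value_set A (\<Omega>s n) (Ms n) (\<mu>s n)))
             \<longlonglongrightarrow> 1 / real (card A ^ card A)"
    proof (rule tendsto_sandwich)
      show "\<forall>\<^sub>F n in sequentially. 1 / real (card A ^ card A)
          \<le> measure (env_lebesgue A (\<Omega>s n)) (no_value_set A (\<Omega>s n) (Ms n) (\<mu>s n))"
        using persuasion.no_value_measure_ge[OF g] by (intro always_eventually allI)
      show "\<forall>\<^sub>F n in sequentially. measure (env_lebesgue A (\<Omega>s n)) (no_value_set A (\<Omega>s n) (Ms n) (\<mu>s n))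
          \<le> 1 / real (card A ^ card A) + real (card A) * \<theta> ^ card (\<Omega>s n)"
        using persuasion.no_value_measure_le[OF g] unfolding \<theta>_def by (intro always_eventually allI)
      have "(\<lambda>n. \<theta> ^ card (\<Omega>s n)) \<longlonglongrightarrow> 0"
        by (rule filterlim_compose[OF LIMSEQ_power_zero]) (use * \<theta> in auto)
      then have "(\<lambda>n. 1 / real (card A ^ card A) + real (card A) * \<theta> ^ card (\<Omega>s n))
          \<longlonglongrightarrow> 1 / real (card A ^ card A) + real (card A) * 0"
        by (intro tendsto_intros)
      then show "(\<lambda>n. 1 / real (card A ^ card A) + real (card A) * \<theta> ^ card (\<Omega>s n))
          \<longlonglongrightarrow> 1 / real (card A ^ card A)" by simp
    qed simp
  qed
qed

end
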